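(* For each integer $k>2$ there exists a polynomial $p$ of degree $k$ such that the spectrum $\sigma(T_{\overline{z}+p})$ of the Bergman-space Toeplitz operator $T_{\overline{z}+p}$ has an isolated point, and hence is disconnected.
   Context: $\mathbb D$ is the open unit disk, $dA$ normalized area measure on $\mathbb D$, $L^2_a$ the Bergman space of analytic functions in $L^2(\mathbb D,dA)$, $P$ the orthogonal projection onto $L^2_a$, and $T_\varphi f=P(\varphi f)$ for $\varphi\in L^\infty(\mathbb D)$, $f\in L^2_a$. *)

theory Defs
  imports "HOL-Analysis.Analysis" "HOL-Computational_Algebra.Polynomial"
begin

definition disk :: "complex set" where
  "disk = ball 0 1"

definition dA_integral :: "(complex \<Rightarrow> complex) \<Rightarrow> complex" where
  "dA_integral g = complex_of_real (1 / pi) * (LINT z : disk | lborel. g z)"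

definition L2_disk :: "(complex \<Rightarrow> complex) set" where
  "L2_disk = {f. f \<in> borel_measurable lborel \<and>
                 set_integrable lborel disk (\<lambda>z. (cmod (f z))\<^sup>2)}"

text \<open>Bergman space: analytic functions on D that are square integrable w.r.t. dA.
  The canonical representative is taken to vanish outside the disk.\<close>
definition bergman :: "(complex \<Rightarrow> complex) set" where
  "bergman = {f. f holomorphic_on disk \<and> (\<forall>z. z \<notin> disk \<longrightarrow> f z = 0) \<and>
                 set_integrable lborel disk (\<lambda>z. (cmod (f z))\<^sup>2)}"

definition L2_inner :: "(complex \<Rightarrow> complex) \<Rightarrow> (complex \<Rightarrow> complex) \<Rightarrow> complex" where
  "L2_inner f g = dA_integral (\<lambda>z. f z * cnj (g z))"

definition L2_norm :: "(complex \<Rightarrow> complex) \<Rightarrow> real" where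
  "L2_norm f = sqrt ((1 / pi) * (LINT z : disk | lborel. (cmod (f z))\<^sup>2))"

definition bergman_proj :: "(complex \<Rightarrow> complex) \<Rightarrow> (complex \<Rightarrow> complex)" where
  "bergman_proj g = (THE h. h \<in> bergman \<and>
       (\<forall>k\<in>bergman. L2_inner (\<lambda>z. g z - h z) k = 0))"

definition toeplitz :: "(complex \<Rightarrow> complex) \<Rightarrow> (complex \<Rightarrow> complex) \<Rightarrow> (complex \<Rightarrow> complex)" where
  "toeplitz \<phi> f = bergman_proj (\<lambda>z. \<phi> z * f z)"

definition bergman_invertible :: "((complex \<Rightarrow> complex) \<Rightarrow> (complex \<Rightarrow> complex)) \<Rightarrow> bool" where
  "bergman_invertible A \<longleftrightarrow>
     (\<exists>S. (\<forall>f\<in>bergman. S f \<in> bergman) \<and>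
          (\<forall>f\<in>bergman. \<forall>g\<in>bergman. \<forall>a b. S (\<lambda>z. a * f z + b * g z) = (\<lambda>z. a * S f z + b * S g z)) \<and>
          (\<exists>C. \<forall>f\<in>bergman. L2_norm (S f) \<le> C * L2_norm f) \<and>
          (\<forall>f\<in>bergman. S (A f) = f) \<and>
          (\<forall>f\<in>bergman. A (S f) = f))"

definition bergman_spectrum :: "((complex \<Rightarrow> complex) \<Rightarrow> (complex \<Rightarrow> complex)) \<Rightarrow> complex set" where
  "bergman_spectrum T = {c. \<not> bergman_invertible (\<lambda>f z. T f z - c * f z)}"

definition isolated_point_of :: "complex \<Rightarrow> complex set \<Rightarrow> bool" where
  "isolated_point_of x S \<longleftrightarrow> x \<in> S \<and> (\<exists>e>0. S \<inter> ball x e = {x})"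

end

theory Submission
  imports Defs "HOL-Complex_Analysis.Complex_Analysis"
begin

text \<open>
  Write \<open>f = (z g)'\<close>. On monomials one reads off that \<open>P (cnj z f) = g'\<close>, so with
  \<open>q = p - c\<close> and \<open>r = 1 + z q\<close> the operator \<open>T - c\<close> becomes the first order differential
  operator \<open>g \<mapsto> r g' + q g\<close>. Suppose that \<open>r = (z - a) R\<close> with \<open>a\<close> in the disk and \<open>R\<close>
  free of zeros on the closed disk. A zero-free integrating factor \<open>E\<close>, \<open>g = E u\<close>, reduces
  the equation to \<open>(z - a) u' - \<mu> u = h / (E R)\<close> with \<open>\<mu> = 1 / (a R(a))\<close>. If \<open>\<mu>\<close> is a
  natural number then \<open>u = (z - a) ^ \<mu>\<close> spans a kernel; otherwise the equation is uniquely
  solvable with bounds, since the Taylor coefficients of \<open>u'\<close> satisfy a backward recursion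
  that contracts with asymptotic ratio \<open>|a| < 1\<close>.

  Now choose \<open>p\<close> so that \<open>1 + z p = (1 - z / a) (1 - s z / a) ^ k\<close> with \<open>|s| < a < 1\<close> and
  \<open>(1 - s) ^ k = - 1 / 2\<close>, which is possible because \<open>k > 2\<close>. Then \<open>\<mu> = 2\<close> at
  \<open>c = 0\<close>, while for small \<open>c \<noteq> 0\<close> the root \<open>a\<close> and hence \<open>\<mu>\<close> move and \<open>\<mu>\<close> is no natural
  number: \<open>0\<close> is an isolated point of the spectrum. The values of the symbol on the unit circle
  also belong to the spectrum and are nonzero.
\<close>

section \<open>Integrals of power series over disks\<close>

text \<open>On the unit circle \<open>cnj z = 1 / z\<close>, so the symbol minus \<open>c\<close>
  equals \<open>r / z\<close> there, and a single zero of \<open>r\<close> in the disk means winding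
  number zero. On the Hardy space this would already force invertibility. On the Bergman space the
  exponent \<open>\<mu>\<close> of the equation at its singular point \<open>a\<close> still
  decides, and this is what makes isolated spectral points possible. With the chosen
  \<open>r\<close> one has \<open>a R(a) = - (1 - s) ^ k\<close>, so \<open>\<mu> = 2\<close> says
  exactly \<open>(1 - s) ^ k = - 1 / 2\<close>. The condition \<open>|s| < 1\<close> puts
  \<open>1 - s\<close> into the right half plane, where a \<open>k\<close>-th power can be negative
  only for \<open>k > 2\<close>. For \<open>k = 3\<close> the admissible \<open>1 - s\<close> with
  negative cube have modulus below 1, which excludes \<open>\<mu> = 1\<close>; the value 2 is the
  first that serves every \<open>k\<close>. That \<open>\<mu>\<close> leaves 2 when \<open>c\<close>
  leaves 0 rests on \<open>1 / \<mu>\<close> being the value at the moved root of the polynomial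
  \<open>z r' - r\<close>, which is not constant. An isolated point disconnects the spectrum only if
  there is a second point; the circle values supply it.\<close>

lemma distr_lborel_vec2_complex:
  "distr lborel borel (\<lambda>v::real^2. Complex (v $ 1) (v $ 2)) = (lborel :: complex measure)"
proof (rule lborel_eqI[symmetric])
  fix l u :: complex
  assume le: "\<And>b. b \<in> Basis \<Longrightarrow> l \<bullet> b \<le> u \<bullet> b"
  have [measurable]: "(\<lambda>v::real^2. Complex (v $ 1) (v $ 2)) \<in> borel_measurable borel"
    by (intro borel_measurable_continuous_onI continuous_intros)
  let ?L = "vector [Re l, Im l] :: real^2" and ?U = "vector [Re u, Im u] :: real^2"
  have vimage: "(\<lambda>v::real^2. Complex (v $ 1) (v $ 2)) -` box l u = box ?L ?U"
    by (auto simp: mem_box_cart in_box_complex_iff forall_2)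
  have B: "(Basis :: (real^2) set) = {axis 1 1, axis 2 1}"
    by (auto simp: Basis_vec_def UNIV_2)
  have le': "?L \<bullet> b \<le> ?U \<bullet> b" if "b \<in> Basis" for b
    using that le[of 1] le[of \<i>] by (auto simp: B inner_axis)
  have "emeasure lborel (box ?L ?U) = (\<Prod>b\<in>Basis. (?U - ?L) \<bullet> b)"
    using le' by (rule emeasure_lborel_box)
  also have "\<dots> = (\<Prod>b\<in>Basis. (u - l) \<bullet> b)"
    by (simp add: B inner_axis axis_eq_axis Basis_complex_def)
  finally show "emeasure (distr lborel borel (\<lambda>v::real^2. Complex (v $ 1) (v $ 2))) (box l u) =
      ennreal (\<Prod>b\<in>Basis. (u - l) \<bullet> b)"
    by (simp add: emeasure_distr vimage)
qed simp

text \<open>In real coordinates, multiplication by a unimodular number is an orthogonal map, and the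
  preimage of a box is the image of that box under the inverse rotation. The passage through
  \<open>real^2\<close> gives access to the invariance of Lebesgue measure under orthogonal
  maps.\<close>

lemma distr_lborel_rotation:
  fixes w :: complex
  assumes w: "cmod w = 1"
  shows "distr lborel borel ((*) w) = lborel"
proof (rule lborel_eqI[symmetric])
  fix l u :: complex
  assume le: "\<And>b. b \<in> Basis \<Longrightarrow> l \<bullet> b \<le> u \<bullet> b"
  define V where "V = (\<lambda>v::real^2. Complex (v $ 1) (v $ 2))"
  define W where "W = (\<lambda>z. vector [Re z, Im z] :: real^2)"
  have [measurable]: "V \<in> borel_measurable borel" unfolding V_def
    by (intro borel_measurable_continuous_onI continuous_intros)
  have VW[simp]: "V (W z) = z" "W (V v) = v" for z v
    by (auto simp: V_def W_def vec_eq_iff forall_2)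
  have emV: "emeasure lborel (V -` S) = emeasure lborel S" if "S \<in> sets borel" for S
  proof -
    have "emeasure lborel S = emeasure (distr lborel borel V) S"
      by (simp add: distr_lborel_vec2_complex V_def)
    also have "\<dots> = emeasure lborel (V -` S)"
      using that by (subst emeasure_distr) auto
    finally show ?thesis ..
  qed
  \<comment> \<open>Multiplication by \<open>cnj w\<close>, the inverse of multiplication by
    \<open>w\<close>, read in coordinates: it turns the preimage of a box into an image.\<close>
  define R where "R = (\<lambda>v. W (cnj w * V v))"
  have "linear R"
    by (rule linearI) (auto simp: R_def V_def W_def vec_eq_iff forall_2 algebra_simps)
  moreover have "norm (R v) = norm v" for v
  proof -
    have nW: "norm (W z) = cmod z" for z
      by (simp add: norm_vec_def W_def L2_set_def UNIV_2 cmod_def)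
    have "norm v = cmod (V v)" using nW[of "V v"] by simp
    then show ?thesis using w by (simp add: R_def nW norm_mult)
  qed
  ultimately have orth: "orthogonal_transformation R"
    by (simp add: orthogonal_transformation)
  let ?S = "V -` box l u"
  have S: "?S \<in> sets borel" using measurable_sets_borel[of V borel "box l u"] by simp
  have finS: "emeasure lborel ?S < \<infinity>" by (simp add: emV emeasure_lborel_box_eq)
  have im: "V -` ((*) w -` box l u) = R ` ?S"
  proof (intro set_eqI iffI)
    fix v assume v: "v \<in> V -` ((*) w -` box l u)"
    have "cnj w * (w * V v) = V v" using w
      by (metis complex_norm_square mult.assoc mult.commute mult_1 of_real_1 one_power2)
    then have "v = R (W (w * V v))" by (simp only: R_def VW)
    moreover have "W (w * V v) \<in> ?S" using v by simp
    ultimately show "v \<in> R ` ?S" by blast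
  next
    fix v assume "v \<in> R ` ?S"
    then obtain x where x: "V x \<in> box l u" "v = R x" by auto
    have "w * (cnj w * V x) = V x" using w
      by (metis complex_norm_square mult.assoc mult_1 of_real_1 one_power2)
    then have "w * V v = V x" by (simp only: x R_def VW)
    then show "v \<in> V -` ((*) w -` box l u)" using x by simp
  qed
  have lm: "?S \<in> lmeasurable"
    using S finS by (auto simp: fmeasurable_def)
  have mw: "(*) w -` box l u \<in> sets borel"
    using measurable_sets_borel[of "(*) w" borel "box l u"] by simp
  have RS: "R ` ?S \<in> sets borel"
    unfolding im[symmetric] using mw measurable_sets_borel[of V borel] by simp
  have "emeasure lborel ((*) w -` box l u) = emeasure lborel (R ` ?S)"
    using emV[OF mw] by (simp add: im)
  also have "\<dots> = emeasure lebesgue (R ` ?S)" using RS by simp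
  also have "\<dots> = ennreal (measure lebesgue (R ` ?S))"
    using measurable_orthogonal_image[OF orth lm] by (simp add: emeasure_eq_measure2)
  also have "\<dots> = ennreal (measure lebesgue ?S)"
    by (simp add: measure_orthogonal_image[OF orth lm])
  also have "\<dots> = emeasure lebesgue ?S" using lm by (simp add: emeasure_eq_measure2)
  also have "\<dots> = emeasure lborel (box l u)" using S by (simp add: emV)
  also have "\<dots> = ennreal (\<Prod>b\<in>Basis. (u - l) \<bullet> b)" using le by (rule emeasure_lborel_box)
  finally show "emeasure (distr lborel borel ((*) w)) (box l u) = ennreal (\<Prod>b\<in>Basis. (u - l) \<bullet> b)"
    by (simp add: emeasure_distr)
qed simp

text \<open>The substitution \<open>z \<mapsto> w z\<close> with \<open>|w| = 1\<close> preserves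
  the measure and the ball but multiplies the integrand by \<open>w ^ m * cnj w ^ n\<close>. One
  \<open>w\<close> for which this factor differs from 1 forces the integral to vanish.\<close>

lemma set_integral_ball_monomial_orthogonal:
  assumes "m \<noteq> n"
  shows "(LINT z:ball 0 \<rho>|lborel. z ^ m * cnj z ^ n) = (0::complex)"
proof -
  \<comment> \<open>Small enough that \<open>|(m - n) t| \<le> 1 < 2 pi\<close>, hence a nonzero
    angle that is no multiple of \<open>2 pi\<close>.\<close>
  define t :: real where "t = 1 / (real m + real n + 1)"
  define w where "w = cis t"
  have w: "cmod w = 1" "w ^ m * cnj w ^ n \<noteq> 1"
  proof -
    show "cmod w = 1" by (simp add: w_def)
    let ?x = "(real m - real n) * t"
    have "w ^ m * cnj w ^ n = cis ?x"
      by (simp only: w_def cis_cnj Complex.DeMoivre cis_mult) (simp add: algebra_simps)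
    moreover have "cis ?x \<noteq> 1"
    proof
      assume "cis ?x = 1"
      then have "cos ?x = 1" by (metis cis.sel(1) one_complex.sel(1))
      then obtain k :: int where k: "?x = of_int k * 2 * pi"
        using cos_one_2pi_int[of ?x] by auto
      have "?x \<noteq> 0" using assms by (auto simp: t_def)
      then have "1 \<le> \<bar>real_of_int k\<bar>" using k by (cases "k = 0") auto
      moreover have "3 < 2 * pi" using pi_gt3 by simp
      ultimately have "1 * 3 < \<bar>real_of_int k\<bar> * (2 * pi)"
        by (intro mult_le_less_imp_less) auto
      also have "\<dots> = \<bar>?x\<bar>" unfolding k by (simp add: abs_mult)
      also have "\<dots> \<le> 1" by (auto simp: t_def abs_if field_simps)
      finally show False by simp
    qed
    ultimately show "w ^ m * cnj w ^ n \<noteq> 1" by simp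
  qed
  let ?f = "\<lambda>z::complex. indicator (ball 0 \<rho>) z *\<^sub>R (z ^ m * cnj z ^ n)"
  have [measurable]: "?f \<in> borel_measurable borel"
    by (intro borel_measurable_indicator borel_measurable_scaleR borel_measurable_continuous_onI continuous_intros) auto
  have "integral\<^sup>L lborel ?f = integral\<^sup>L (distr lborel borel ((*) w)) ?f"
    by (simp add: distr_lborel_rotation w)
  also have "\<dots> = (\<integral>z. ?f (w * z) \<partial>lborel)"
    by (subst integral_distr) auto
  also have "\<dots> = (\<integral>z. (w ^ m * cnj w ^ n) * ?f z \<partial>lborel)"
    using w by (intro Bochner_Integration.integral_cong) (auto simp: indicator_def norm_mult power_mult_distrib)
  also have "\<dots> = (w ^ m * cnj w ^ n) * integral\<^sup>L lborel ?f"
    by (rule integral_mult_right_zero)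
  finally show ?thesis using w(2) by (auto simp: set_lebesgue_integral_def)
qed

text \<open>A substitute for polar coordinates: the disk \<open>|z|^2 < t\<close> has area
  \<open>pi t\<close>, so \<open>|z|^2\<close> is uniformly distributed with density
  \<open>pi\<close>. Radial integrals become integrals over an interval. It suffices to compare the
  measures of the half lines \<open>{x<..}\<close>.\<close>

lemma distr_ball_cmod_square:
  assumes "\<rho> \<ge> 0"
  shows "distr (density lborel (indicator (ball (0::complex) \<rho>))) borel (\<lambda>z. (cmod z)\<^sup>2) =
    density lborel (\<lambda>t. ennreal pi * indicator {0..\<rho>\<^sup>2} t)" (is "?M = ?N")
proof (rule measure_eqI_lessThan)
  have M: "emeasure ?M {x<..} = emeasure lborel (ball 0 \<rho> \<inter> {z::complex. x < (cmod z)\<^sup>2})" for x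
  proof -
    have [measurable]: "{z::complex. x < (cmod z)\<^sup>2} \<in> sets borel" by measurable
    have "emeasure ?M {x<..} = emeasure (density lborel (indicator (ball (0::complex) \<rho>))) {z. x < (cmod z)\<^sup>2}"
      by (subst emeasure_distr) (auto simp: vimage_def)
    also have "\<dots> = (\<integral>\<^sup>+z. indicator (ball (0::complex) \<rho>) z * indicator {z. x < (cmod z)\<^sup>2} z \<partial>lborel)"
      by (subst emeasure_density) (auto intro!: borel_measurable_indicator)
    also have "\<dots> = (\<integral>\<^sup>+z. indicator (ball (0::complex) \<rho> \<inter> {z. x < (cmod z)\<^sup>2}) z \<partial>lborel)"
      by (simp add: indicator_inter_arith)
    also have "\<dots> = emeasure lborel (ball 0 \<rho> \<inter> {z::complex. x < (cmod z)\<^sup>2})"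
      by (subst nn_integral_indicator) auto
    finally show ?thesis .
  qed
  have N: "emeasure ?N {x<..} = ennreal pi * emeasure lborel ({0..\<rho>\<^sup>2} \<inter> {x<..})" for x :: real
  proof -
    have "emeasure ?N {x<..} = (\<integral>\<^sup>+t. ennreal pi * indicator ({0..\<rho>\<^sup>2} \<inter> {x<..}) t \<partial>lborel)"
      by (subst emeasure_density) (auto simp: indicator_inter_arith mult.assoc)
    also have "\<dots> = ennreal pi * emeasure lborel ({0..\<rho>\<^sup>2} \<inter> {x<..})"
      by (subst nn_integral_cmult_indicator) auto
    finally show ?thesis .
  qed
  have ball: "emeasure lborel (ball (0::complex) r) = ennreal (pi * r\<^sup>2)" if "r \<ge> 0" for r
    using emeasure_ball[of r "0::complex"] that by (simp add: unit_ball_vol_2)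
  have cball: "emeasure lborel (cball (0::complex) r) = ennreal (pi * r\<^sup>2)" if "r \<ge> 0" for r
    using emeasure_cball[of r "0::complex"] that by (simp add: unit_ball_vol_2)
  show "emeasure ?M {x<..} = emeasure ?N {x<..}" for x
  proof -
    consider "x < 0" | "0 \<le> x" "x < \<rho>\<^sup>2" | "\<rho>\<^sup>2 \<le> x" by linarith
    then show ?thesis
    proof cases
      case 1
      then have "ball 0 \<rho> \<inter> {z::complex. x < (cmod z)\<^sup>2} = ball 0 \<rho>"
        by (auto intro: less_le_trans)
      moreover have "{0..\<rho>\<^sup>2} \<inter> {x<..} = {0..\<rho>\<^sup>2}" using 1 by auto
      ultimately show ?thesis using assms by (simp add: M N ball ennreal_mult)
    next
      case 2
      have x2: "(sqrt x)\<^sup>2 = x" using 2 by simp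
      have lt: "x < (cmod z)\<^sup>2 \<longleftrightarrow> \<not> cmod z \<le> sqrt x" for z
        using abs_le_square_iff[of "cmod z" "sqrt x"] 2 by (simp add: not_le)
      have "sqrt x < \<rho>" using 2 assms real_less_lsqrt by blast
      then have sub: "cball 0 (sqrt x) \<subseteq> ball (0::complex) \<rho>" by auto
      have "emeasure lborel (ball 0 \<rho> \<inter> {z::complex. x < (cmod z)\<^sup>2}) = emeasure lborel (ball (0::complex) \<rho> - cball 0 (sqrt x))"
        by (rule arg_cong[where f="emeasure lborel"]) (auto simp: lt)
      also have "\<dots> = emeasure lborel (ball (0::complex) \<rho>) - emeasure lborel (cball (0::complex) (sqrt x))"
        using sub 2 by (subst emeasure_Diff) (auto simp: cball)
      also have "\<dots> = ennreal (pi * (\<rho>\<^sup>2 - x))"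
        using 2 assms by (simp add: ball cball ennreal_minus algebra_simps)
      finally have "emeasure lborel (ball 0 \<rho> \<inter> {z::complex. x < (cmod z)\<^sup>2}) = ennreal (pi * (\<rho>\<^sup>2 - x))" .
      moreover have "{0..\<rho>\<^sup>2} \<inter> {x<..} = {x<..\<rho>\<^sup>2}" using 2 by auto
      ultimately show ?thesis using 2 by (simp add: M N ennreal_mult)
    next
      case 3
      have "(cmod z)\<^sup>2 \<le> x" if "cmod z < \<rho>" for z
        using power_mono[of "cmod z" \<rho> 2] that 3 by simp
      then have "ball 0 \<rho> \<inter> {z::complex. x < (cmod z)\<^sup>2} = {}"
        by (auto simp flip: not_le)
      moreover have "{0..\<rho>\<^sup>2} \<inter> {x<..} = {}" using 3 by auto
      ultimately show ?thesis by (simp add: M N)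
    qed
  qed
  show "emeasure ?M {x<..} < \<infinity>" for x
  proof -
    have "emeasure ?M {x<..} \<le> emeasure lborel (ball (0::complex) \<rho>)"
      unfolding M by (intro emeasure_mono) auto
    also have "\<dots> < \<infinity>" using assms by (simp add: ball)
    finally show ?thesis .
  qed
qed auto

lemma set_integral_ball_monomial_square:
  assumes "\<rho> \<ge> 0"
  shows "(LINT z:ball 0 \<rho>|lborel. z ^ n * cnj z ^ n) = complex_of_real (pi * \<rho> ^ (2 * n + 2) / (real n + 1))"
proof -
  have eq: "z ^ n * cnj z ^ n = complex_of_real (((cmod z)\<^sup>2) ^ n)" for z
    by (subst of_real_power) (simp only: complex_norm_square power_mult_distrib)
  have "(LINT z:ball 0 \<rho>|lborel. z ^ n * cnj z ^ n) =
      (\<integral>z. complex_of_real (indicator (ball 0 \<rho>) z * ((cmod z)\<^sup>2) ^ n) \<partial>lborel)"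
    unfolding set_lebesgue_integral_def
    by (intro Bochner_Integration.integral_cong) (auto simp: indicator_def eq)
  also have "\<dots> = complex_of_real (\<integral>z. indicator (ball 0 \<rho>) z * ((cmod z)\<^sup>2) ^ n \<partial>lborel)"
    by (rule integral_complex_of_real)
  also have "(\<integral>z. indicator (ball 0 \<rho>) z * ((cmod z)\<^sup>2) ^ n \<partial>lborel) =
     (\<integral>z. ((cmod z)\<^sup>2) ^ n \<partial>density lborel (\<lambda>z. ennreal (indicator (ball (0::complex) \<rho>) z)))"
    by (subst integral_density) (auto intro!: borel_measurable_indicator)
  also have "\<dots> = (\<integral>t. t ^ n \<partial>distr (density lborel (indicator (ball (0::complex) \<rho>))) borel (\<lambda>z. (cmod z)\<^sup>2))"
    by (subst integral_distr) (auto simp: ennreal_indicator)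
  also have "\<dots> = (\<integral>t. t ^ n \<partial>density lborel (\<lambda>t. ennreal (pi * indicator {0..\<rho>\<^sup>2} t)))"
    by (simp add: distr_ball_cmod_square assms ennreal_mult ennreal_indicator)
  also have "\<dots> = (\<integral>t. pi * (t ^ n * indicator {0..\<rho>\<^sup>2} t) \<partial>lborel)"
    by (subst integral_density) (auto simp: mult_ac)
  also have "\<dots> = pi * ((\<rho>\<^sup>2) ^ Suc n / Suc n)"
    by (subst integral_mult_right_zero, subst integral_power) auto
  also have "\<dots> = pi * \<rho> ^ (2 * n + 2) / (real n + 1)"
    by (simp add: power_add power_mult power2_eq_square add.commute)
  finally show ?thesis .
qed

section \<open>Power series on the disk: Parseval's formula and the Bergman norm in
  coefficients\<close>

definition pser :: "(nat \<Rightarrow> complex) \<Rightarrow> (complex \<Rightarrow> complex) \<Rightarrow> bool" where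
  "pser c f \<longleftrightarrow> (\<forall>z\<in>disk. (\<lambda>n. c n * z ^ n) sums f z)"

lemma pserD: "pser c f \<Longrightarrow> cmod z < 1 \<Longrightarrow> (\<lambda>n. c n * z ^ n) sums f z"
  by (simp add: pser_def disk_def)

lemma pser_summable_norm:
  assumes "pser c f" "0 \<le> \<rho>" "\<rho> < 1"
  shows "summable (\<lambda>n. cmod (c n) * \<rho> ^ n)"
proof -
  have "summable (\<lambda>n. c n * complex_of_real ((1 + \<rho>) / 2) ^ n)"
    using pserD[OF assms(1), of "complex_of_real ((1 + \<rho>) / 2)"] assms
    by (auto simp: sums_iff norm_divide simp flip: of_real_add)
  then have "summable (\<lambda>n. norm (c n * complex_of_real \<rho> ^ n))"
    by (rule powser_insidea) (use assms in \<open>auto simp del: of_real_add of_real_divide\<close>)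
  then show ?thesis using assms by (simp add: norm_mult norm_power)
qed

text \<open>Strictly inside the unit disk the series converges absolutely and uniformly and
  \<open>\<phi>\<close> is bounded, so sum and integral may be exchanged. The limit of the radius to
  1 is taken only later, where it needs integrability.\<close>

lemma pser_set_integral_sums:
  assumes f: "pser c f" and \<rho>: "0 \<le> \<rho>" "\<rho> < 1" and \<phi>: "continuous_on (cball 0 \<rho>) \<phi>"
  shows "(\<lambda>n. c n * (LINT z:ball 0 \<rho>|lborel. z ^ n * \<phi> z)) sums (LINT z:ball 0 \<rho>|lborel. f z * \<phi> z)"
proof -
  have "bounded (\<phi> ` cball 0 \<rho>)"
    by (intro compact_imp_bounded compact_continuous_image \<phi> compact_cball)
  then obtain M where "M > 0" "\<forall>x\<in>\<phi> ` cball 0 \<rho>. cmod x \<le> M"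
    by (auto simp only: bounded_pos)
  then have M: "\<And>z. z \<in> cball 0 \<rho> \<Longrightarrow> cmod (\<phi> z) \<le> M" "M > 0" by blast+
  let ?F = "\<lambda>n z. indicator (ball 0 \<rho>) z *\<^sub>R (c n * z ^ n * \<phi> z)"
  have meas: "?F n \<in> borel_measurable lborel" for n
  proof -
    have "continuous_on (ball 0 \<rho>) (\<lambda>z. c n * z ^ n * \<phi> z)"
      by (intro continuous_intros continuous_on_subset[OF \<phi>]) auto
    then show ?thesis
      by (simp add: borel_measurable_continuous_on_indicator)
  qed
  have bound: "norm (?F n z) \<le> indicator (ball 0 \<rho>) z * (cmod (c n) * \<rho> ^ n * M)" for n z
    using M \<rho> by (auto simp: indicator_def norm_mult norm_power intro!: mult_mono power_mono)
  have bint: "integrable lborel (\<lambda>z. indicator (ball (0::complex) \<rho>) z * (cmod (c n) * \<rho> ^ n * M))" for n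
    by (intro integrable_mult_left integrable_real_indicator emeasure_lborel_ball_finite) simp
  have int: "integrable lborel (?F n)" for n
  proof (rule Bochner_Integration.integrable_bound[OF bint[of n] meas], intro AE_I2)
    show "norm (?F n z) \<le> norm (indicator (ball 0 \<rho>) z * (cmod (c n) * \<rho> ^ n * M))" for z
      using bound[where n=n and z=z] by (metis abs_ge_self order.trans real_norm_def)
  qed
  have sm: "summable (\<lambda>n. cmod (c n) * \<rho> ^ n * M)"
    using pser_summable_norm[OF f \<rho>] by (rule summable_mult2)
  have sums: "(\<lambda>n. integral\<^sup>L lborel (?F n)) sums (\<integral>z. (\<Sum>n. ?F n z) \<partial>lborel)"
  proof (rule sums_integral[OF int])
    show "AE z in lborel. summable (\<lambda>n. norm (?F n z))"
      using bound by (intro AE_I2 summable_comparison_test'[OF summable_mult[OF sm]]) auto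
    have "norm (\<integral>z. norm (?F n z) \<partial>lborel) \<le> measure lborel (ball (0::complex) \<rho>) * (cmod (c n) * \<rho> ^ n * M)" for n
    proof -
      have "(\<integral>z. norm (?F n z) \<partial>lborel) \<le> (\<integral>z. indicator (ball (0::complex) \<rho>) z * (cmod (c n) * \<rho> ^ n * M) \<partial>lborel)"
        by (rule Bochner_Integration.integral_mono) (rule integrable_norm[OF int] bint bound)+
      then show ?thesis by simp
    qed
    then show "summable (\<lambda>n. \<integral>z. norm (?F n z) \<partial>lborel)"
      by (intro summable_comparison_test'[OF summable_mult[OF sm]]) auto
  qed
  have "(\<Sum>n. ?F n z) = indicator (ball 0 \<rho>) z *\<^sub>R (f z * \<phi> z)" for z
  proof (cases "z \<in> ball 0 \<rho>")
    case True
    then have "(\<lambda>n. c n * z ^ n * \<phi> z) sums (f z * \<phi> z)"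
      using \<rho> by (intro sums_mult2 pserD[OF f]) auto
    then show ?thesis using True by (simp add: sums_iff)
  qed simp
  moreover have "integral\<^sup>L lborel (?F n) = c n * (LINT z:ball 0 \<rho>|lborel. z ^ n * \<phi> z)" for n
    unfolding set_lebesgue_integral_def
    by (subst integral_mult_right_zero[symmetric]) (auto simp: mult_ac intro!: Bochner_Integration.integral_cong)
  ultimately show ?thesis using sums by (simp add: set_lebesgue_integral_def)
qed

lemma pser_holomorphic:
  assumes "pser c f"
  shows "f holomorphic_on disk"
  unfolding disk_def
  by (rule power_series_holomorphic[of 0 1 c]) (use pserD[OF assms] in auto)

lemma holomorphic_imp_pser:
  assumes "f holomorphic_on disk"
  obtains c where "pser c f"
proof
  show "pser (\<lambda>n. (deriv ^^ n) f 0 / fact n) f"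
    using holomorphic_power_series[of f 0 1] assms by (auto simp: pser_def disk_def)
qed

text \<open>Termwise integration is used twice: expanding \<open>g\<close> against
  \<open>cnj z ^ n\<close> isolates its \<open>n\<close>-th coefficient by orthogonality, then
  expanding \<open>f\<close> against \<open>cnj g\<close> sums up the results.\<close>

lemma pser_parseval_ball:
  assumes f: "pser a f" and g: "pser b g" and \<rho>: "0 \<le> \<rho>" "\<rho> < 1"
  shows "(\<lambda>n. a n * cnj (b n) * complex_of_real (pi * \<rho> ^ (2 * n + 2) / (real n + 1)))
    sums (LINT z:ball 0 \<rho>|lborel. f z * cnj (g z))"
proof -
  have mono: "(LINT z:ball 0 \<rho>|lborel. z ^ n * cnj (g z)) =
      cnj (b n) * complex_of_real (pi * \<rho> ^ (2 * n + 2) / (real n + 1))" for n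
  proof -
    let ?I = "complex_of_real (pi * \<rho> ^ (2 * n + 2) / (real n + 1))"
    have "(\<lambda>m. b m * (LINT z:ball 0 \<rho>|lborel. z ^ m * cnj z ^ n)) sums (LINT z:ball 0 \<rho>|lborel. g z * cnj z ^ n)"
      by (rule pser_set_integral_sums[OF g \<rho>]) (intro continuous_intros)
    moreover have "(\<lambda>m. b m * (LINT z:ball 0 \<rho>|lborel. z ^ m * cnj z ^ n)) = (\<lambda>m. if m = n then b m * ?I else 0)"
      using set_integral_ball_monomial_square[OF \<rho>(1), of n] set_integral_ball_monomial_orthogonal[of _ n \<rho>]
      by auto
    ultimately have "(LINT z:ball 0 \<rho>|lborel. g z * cnj z ^ n) = b n * ?I"
      using sums_single[of n "\<lambda>m. b m * ?I"] sums_unique2 by fastforce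
    then have "cnj (LINT z:ball 0 \<rho>|lborel. g z * cnj z ^ n) = cnj (b n) * ?I" by simp
    moreover have "cnj (LINT z:ball 0 \<rho>|lborel. g z * cnj z ^ n) = (LINT z:ball 0 \<rho>|lborel. z ^ n * cnj (g z))"
      unfolding set_lebesgue_integral_def
      by (subst Bochner_Integration.integral_cnj[symmetric]) (auto simp: mult_ac intro!: Bochner_Integration.integral_cong)
    ultimately show ?thesis by simp
  qed
  have "continuous_on (cball 0 \<rho>) (\<lambda>z. cnj (g z))"
    using \<rho> holomorphic_on_imp_continuous_on[OF pser_holomorphic[OF g]]
    by (intro continuous_intros) (auto simp: disk_def intro: continuous_on_subset)
  from pser_set_integral_sums[OF f \<rho> this] show ?thesis
    by (simp only: mono mult.assoc)
qed

lemma pser_nn_integral_ball: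
  assumes f: "pser a f" and \<rho>: "0 \<le> \<rho>" "\<rho> < 1"
  shows "(\<integral>\<^sup>+z. ennreal (indicator (ball 0 \<rho>) z * (cmod (f z))\<^sup>2) \<partial>lborel) =
    (\<Sum>n. ennreal (pi * (cmod (a n))\<^sup>2 / (real n + 1) * \<rho> ^ (2 * n + 2)))"
proof -
  let ?F = "\<lambda>z. indicator (ball 0 \<rho>) z * (cmod (f z))\<^sup>2"
  let ?t = "\<lambda>n. pi * (cmod (a n))\<^sup>2 / (real n + 1) * \<rho> ^ (2 * n + 2)"
  have cont: "continuous_on (cball 0 \<rho>) f"
    using \<rho> holomorphic_on_imp_continuous_on[OF pser_holomorphic[OF f]]
    by (rule_tac continuous_on_subset) (auto simp: disk_def)
  have "set_integrable lborel (cball 0 \<rho>) (\<lambda>z. (cmod (f z))\<^sup>2)"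
    unfolding set_integrable_def
    by (intro borel_integrable_compact) (auto intro!: continuous_intros cont)
  then have "set_integrable lborel (ball 0 \<rho>) (\<lambda>z. (cmod (f z))\<^sup>2)"
    by (rule set_integrable_subset) auto
  then have int: "integrable lborel ?F" by (simp add: set_integrable_def)
  have "a n * cnj (a n) * complex_of_real (pi * \<rho> ^ (2 * n + 2) / (real n + 1)) = complex_of_real (?t n)" for n
    by (simp only: complex_norm_square[symmetric] of_real_mult[symmetric]) (simp add: field_simps)
  moreover have "(LINT z:ball 0 \<rho>|lborel. f z * cnj (f z)) = complex_of_real (integral\<^sup>L lborel ?F)"
    unfolding set_lebesgue_integral_def
    by (subst integral_complex_of_real[symmetric], intro Bochner_Integration.integral_cong)
      (auto simp: indicator_def complex_norm_square simp del: of_real_power)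
  ultimately have sums: "?t sums integral\<^sup>L lborel ?F"
    using pser_parseval_ball[OF f f \<rho>] by (simp only: sums_of_real_iff)
  have "(\<integral>\<^sup>+z. ennreal (?F z) \<partial>lborel) = ennreal (integral\<^sup>L lborel ?F)"
    by (rule nn_integral_eq_integral[OF int]) auto
  also have "\<dots> = (\<Sum>n. ennreal (?t n))"
    using sums \<rho> by (subst suminf_ennreal2) (auto simp: sums_iff)
  finally show ?thesis .
qed

lemma borel_measurable_disk_holomorphic:
  assumes "f holomorphic_on disk"
  shows "set_borel_measurable lborel disk f"
  using borel_measurable_continuous_on_indicator[OF _ holomorphic_on_imp_continuous_on[OF assms]]
  by (simp add: set_borel_measurable_def disk_def)

text \<open>Monotone convergence along radii increasing to 1, on both sides of the identity for
  smaller balls. It is stated in \<open>ennreal\<close> because either side may be infinite;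
  finiteness of one then characterises finiteness of the other.\<close>

lemma pser_nn_integral_disk:
  assumes f: "pser a f"
  shows "(\<integral>\<^sup>+z. ennreal (indicator disk z * (cmod (f z))\<^sup>2) \<partial>lborel) =
    (\<Sum>n. ennreal (pi * (cmod (a n))\<^sup>2 / (real n + 1)))"
proof -
  define \<rho> where "\<rho> = (\<lambda>i::nat. 1 - inverse (real (Suc i)))"
  have \<rho>: "0 \<le> \<rho> i" "\<rho> i < 1" for i by (auto simp: \<rho>_def field_simps)
  have inc: "incseq \<rho>" by (auto simp: incseq_def \<rho>_def field_simps)
  have lim: "\<rho> \<longlonglongrightarrow> 1"
    unfolding \<rho>_def using tendsto_diff[OF tendsto_const LIMSEQ_inverse_real_of_nat, of 1] by simp
  have inc': "incseq (\<lambda>i. ennreal (c * \<rho> i ^ N))" if "c \<ge> 0" for c N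
    using that \<rho> incseq_SucD[OF inc] by (intro incseq_SucI ennreal_leI mult_left_mono power_mono) auto
  have indic: "ennreal (indicator disk z * (cmod (f z))\<^sup>2) =
      (SUP i. ennreal (indicator (ball 0 (\<rho> i)) z * (cmod (f z))\<^sup>2))" for z
  proof (rule antisym)
    show "(SUP i. ennreal (indicator (ball 0 (\<rho> i)) z * (cmod (f z))\<^sup>2)) \<le> ennreal (indicator disk z * (cmod (f z))\<^sup>2)"
      using \<rho>(2) by (intro SUP_least) (auto simp: indicator_def disk_def intro: less_trans)
    show "ennreal (indicator disk z * (cmod (f z))\<^sup>2) \<le> (SUP i. ennreal (indicator (ball 0 (\<rho> i)) z * (cmod (f z))\<^sup>2))"
    proof (cases "z \<in> disk")
      case True
      then have "eventually (\<lambda>i. cmod z < \<rho> i) sequentially"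
        using lim by (intro order_tendstoD) (auto simp: disk_def)
      then obtain i where "cmod z < \<rho> i" by (auto simp: eventually_sequentially)
      then show ?thesis using True by (intro SUP_upper2[of i]) auto
    qed simp
  qed
  have meas [measurable]: "(\<lambda>z. ennreal (indicator (ball 0 (\<rho> i)) z * (cmod (f z))\<^sup>2)) \<in> borel_measurable lborel" for i
  proof -
    have "continuous_on (ball 0 (\<rho> i)) (\<lambda>z. (cmod (f z))\<^sup>2)"
      using \<rho>(2)[of i]
      by (intro continuous_on_power continuous_on_norm
          continuous_on_subset[OF holomorphic_on_imp_continuous_on[OF pser_holomorphic[OF f]]]) (auto simp: disk_def)
    then have "(\<lambda>z. indicator (ball 0 (\<rho> i)) z *\<^sub>R (cmod (f z))\<^sup>2) \<in> borel_measurable borel"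
      by (intro borel_measurable_continuous_on_indicator) auto
    then show ?thesis unfolding measurable_lborel1 by (intro measurable_compose[OF _ measurable_ennreal]) simp
  qed
  have "(\<integral>\<^sup>+z. ennreal (indicator disk z * (cmod (f z))\<^sup>2) \<partial>lborel) =
      (\<integral>\<^sup>+z. (SUP i. ennreal (indicator (ball 0 (\<rho> i)) z * (cmod (f z))\<^sup>2)) \<partial>lborel)"
    by (simp only: indic)
  also have "\<dots> = (SUP i. \<integral>\<^sup>+z. ennreal (indicator (ball 0 (\<rho> i)) z * (cmod (f z))\<^sup>2) \<partial>lborel)"
  proof (intro nn_integral_monotone_convergence_SUP meas incseq_SucI le_funI ennreal_leI mult_right_mono)
    show "indicat_real (ball 0 (\<rho> i)) z \<le> indicat_real (ball 0 (\<rho> (Suc i))) z" for i z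
      using incseq_SucD[OF inc, of i] by (auto simp: indicator_def)
  qed auto
  also have "\<dots> = (SUP i. \<Sum>n. ennreal (pi * (cmod (a n))\<^sup>2 / (real n + 1) * \<rho> i ^ (2 * n + 2)))"
    by (simp only: pser_nn_integral_ball[OF f \<rho>])
  also have "\<dots> = (\<Sum>n. SUP i. ennreal (pi * (cmod (a n))\<^sup>2 / (real n + 1) * \<rho> i ^ (2 * n + 2)))"
    by (intro ennreal_suminf_SUP_eq[symmetric] inc') auto
  also have "\<dots> = (\<Sum>n. ennreal (pi * (cmod (a n))\<^sup>2 / (real n + 1)))"
  proof (rule arg_cong[where f=suminf], rule ext)
    fix n
    let ?c = "pi * (cmod (a n))\<^sup>2 / (real n + 1)"
    have "(\<lambda>i. ennreal (?c * \<rho> i ^ (2 * n + 2))) \<longlonglongrightarrow> ennreal (?c * 1 ^ (2 * n + 2))"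
      by (intro tendsto_ennrealI tendsto_intros lim)
    moreover have "incseq (\<lambda>i. ennreal (?c * \<rho> i ^ (2 * n + 2)))"
      by (intro inc') auto
    ultimately show "(SUP i. ennreal (?c * \<rho> i ^ (2 * n + 2))) = ennreal ?c"
      using LIMSEQ_unique[OF LIMSEQ_SUP] by (simp only: power_one mult_1_right)
  qed
  finally show ?thesis .
qed

lemma pser_integrable_disk_iff:
  assumes f: "pser a f"
  shows "set_integrable lborel disk (\<lambda>z. (cmod (f z))\<^sup>2) \<longleftrightarrow> summable (\<lambda>n. (cmod (a n))\<^sup>2 / (real n + 1))"
proof -
  let ?F = "\<lambda>z. indicator disk z * (cmod (f z))\<^sup>2"
  have F: "?F = (\<lambda>z. (cmod (indicator disk z *\<^sub>R f z))\<^sup>2)"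
    by (auto simp: indicator_def)
  have meas: "?F \<in> borel_measurable lborel"
    unfolding F
    by (rule borel_measurable_power, rule measurable_compose[OF _ borel_measurable_norm])
      (use borel_measurable_disk_holomorphic[OF pser_holomorphic[OF f]] in \<open>simp add: set_borel_measurable_def\<close>)
  have "set_integrable lborel disk (\<lambda>z. (cmod (f z))\<^sup>2) \<longleftrightarrow> (\<integral>\<^sup>+z. ennreal (?F z) \<partial>lborel) < \<infinity>"
    using meas by (simp add: set_integrable_def integrable_iff_bounded abs_mult)
  also have "\<dots> \<longleftrightarrow> (\<Sum>n. ennreal (pi * (cmod (a n))\<^sup>2 / (real n + 1))) \<noteq> top"
    by (simp add: pser_nn_integral_disk[OF f] less_top)
  also have "\<dots> \<longleftrightarrow> summable (\<lambda>n. pi * (cmod (a n))\<^sup>2 / (real n + 1))"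
    by (auto intro: summable_suminf_not_top simp: ennreal_suminf_neq_top)
  also have "\<dots> \<longleftrightarrow> summable (\<lambda>n. pi * ((cmod (a n))\<^sup>2 / (real n + 1)))" by simp
  also have "\<dots> \<longleftrightarrow> summable (\<lambda>n. (cmod (a n))\<^sup>2 / (real n + 1))"
    by (subst summable_cmult_iff) auto
  finally show ?thesis .
qed

lemma pser_L2_norm_sums:
  assumes f: "pser a f" and sm: "summable (\<lambda>n. (cmod (a n))\<^sup>2 / (real n + 1))"
  shows "(\<lambda>n. (cmod (a n))\<^sup>2 / (real n + 1)) sums (L2_norm f)\<^sup>2"
proof -
  let ?F = "\<lambda>z. indicator disk z * (cmod (f z))\<^sup>2"
  let ?S = "\<Sum>n. (cmod (a n))\<^sup>2 / (real n + 1)"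
  have int: "integrable lborel ?F"
    using pser_integrable_disk_iff[OF f] sm by (simp add: set_integrable_def)
  have "ennreal (integral\<^sup>L lborel ?F) = (\<integral>\<^sup>+z. ennreal (?F z) \<partial>lborel)"
    by (rule nn_integral_eq_integral[OF int, symmetric]) auto
  also have "\<dots> = (\<Sum>n. ennreal (pi * ((cmod (a n))\<^sup>2 / (real n + 1))))"
    by (simp add: pser_nn_integral_disk[OF f])
  also have "\<dots> = ennreal (\<Sum>n. pi * ((cmod (a n))\<^sup>2 / (real n + 1)))"
    by (rule suminf_ennreal2) (use summable_mult[OF sm, of pi] in auto)
  also have "(\<Sum>n. pi * ((cmod (a n))\<^sup>2 / (real n + 1))) = pi * ?S"
    by (rule suminf_mult[OF sm])
  finally have "integral\<^sup>L lborel ?F = pi * ?S"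
    using sm by (subst (asm) ennreal_inj) (auto intro!: suminf_nonneg mult_nonneg_nonneg integral_nonneg_AE)
  then have "(L2_norm f)\<^sup>2 = ?S"
    using sm by (auto simp: L2_norm_def set_lebesgue_integral_def intro!: suminf_nonneg)
  then show ?thesis using sm by (simp add: sums_iff)
qed

section \<open>Square-integrable functions and the Bergman projection\<close>

text \<open>Measurability is demanded on the disk only, because functions such as
  \<open>deriv g\<close> are uncontrolled outside it.\<close>

definition sqint :: "(complex \<Rightarrow> complex) \<Rightarrow> bool" where
  "sqint f \<longleftrightarrow> set_borel_measurable lborel disk f \<and> set_integrable lborel disk (\<lambda>z. (cmod (f z))\<^sup>2)"

lemma disk_sets [simp, measurable]: "disk \<in> sets borel"
  by (simp add: disk_def)

lemma bergman_iff:
  "f \<in> bergman \<longleftrightarrow> f holomorphic_on disk \<and> sqint f \<and> (\<forall>z. z \<notin> disk \<longrightarrow> f z = 0)"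
  using borel_measurable_disk_holomorphic by (auto simp: bergman_def sqint_def)

lemma L2_norm_power2: "(L2_norm f)\<^sup>2 = (LINT z:disk|lborel. (cmod (f z))\<^sup>2) / pi"
proof -
  have "0 \<le> (LINT z:disk|lborel. (cmod (f z))\<^sup>2)"
    unfolding set_lebesgue_integral_def by (intro integral_nonneg_AE) auto
  then show ?thesis by (simp add: L2_norm_def)
qed

lemma L2_norm_nonneg: "0 \<le> L2_norm f"
  unfolding L2_norm_def set_lebesgue_integral_def by (auto intro!: integral_nonneg_AE mult_nonneg_nonneg)

lemma L2_norm_cong: "(\<And>z. z \<in> disk \<Longrightarrow> f z = g z) \<Longrightarrow> L2_norm f = L2_norm g"
  unfolding L2_norm_def by (metis (mono_tags, lifting) set_lebesgue_integral_cong disk_sets sets_lborel)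

lemma set_borel_measurable_cong':
  fixes f g :: "complex \<Rightarrow> complex"
  shows "(\<And>z. z \<in> A \<Longrightarrow> f z = g z) \<Longrightarrow> set_borel_measurable M A f = set_borel_measurable M A g"
  unfolding set_borel_measurable_def by (intro arg_cong[where f="\<lambda>h. h \<in> _"] ext) (auto simp: indicator_def)

lemma sqint_cong: "(\<And>z. z \<in> disk \<Longrightarrow> f z = g z) \<Longrightarrow> sqint f = sqint g"
  unfolding sqint_def
  by (intro arg_cong2[where f="(\<and>)"] set_borel_measurable_cong' set_integrable_cong) auto

lemma sqint_bound:
  assumes h: "set_borel_measurable lborel disk h"
    and B: "set_integrable lborel disk B" "\<And>z. z \<in> disk \<Longrightarrow> (cmod (h z))\<^sup>2 \<le> B z"
  shows "sqint h" "(L2_norm h)\<^sup>2 \<le> (LINT z:disk|lborel. B z) / pi"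
proof -
  have meas: "(\<lambda>z. indicator disk z *\<^sub>R (cmod (h z))\<^sup>2) \<in> borel_measurable lborel"
  proof -
    have "(\<lambda>z. indicator disk z *\<^sub>R (cmod (h z))\<^sup>2) = (\<lambda>z. (cmod (indicator disk z *\<^sub>R h z))\<^sup>2)"
      by (auto simp: indicator_def)
    also have "\<dots> \<in> borel_measurable lborel"
      by (rule borel_measurable_power, rule measurable_compose[OF _ borel_measurable_norm])
        (use h in \<open>simp add: set_borel_measurable_def\<close>)
    finally show ?thesis .
  qed
  have int: "set_integrable lborel disk (\<lambda>z. (cmod (h z))\<^sup>2)"
    unfolding set_integrable_def
    by (rule Bochner_Integration.integrable_bound[OF B(1)[unfolded set_integrable_def] meas], intro AE_I2)
      (use B(2) in \<open>auto simp: indicator_def intro: order.trans[OF _ abs_ge_self]\<close>)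
  then show "sqint h" using h by (simp add: sqint_def)
  have "(LINT z:disk|lborel. (cmod (h z))\<^sup>2) \<le> (LINT z:disk|lborel. B z)"
    using B int by (intro set_integral_mono) auto
  then show "(L2_norm h)\<^sup>2 \<le> (LINT z:disk|lborel. B z) / pi"
    by (simp add: L2_norm_power2 divide_right_mono)
qed

lemma cmod_add_square_le: "(cmod (x + y))\<^sup>2 \<le> 2 * (cmod x)\<^sup>2 + 2 * (cmod y)\<^sup>2"
proof -
  have "(cmod (x + y))\<^sup>2 \<le> (cmod x + cmod y)\<^sup>2"
    by (intro power_mono norm_triangle_ineq) auto
  also have "\<dots> \<le> 2 * (cmod x)\<^sup>2 + 2 * (cmod y)\<^sup>2"
    using sum_squares_bound[of "cmod x" "cmod y"] by (simp add: power2_sum)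
  finally show ?thesis .
qed

lemma set_borel_measurable_add:
  fixes f g :: "complex \<Rightarrow> complex"
  assumes "set_borel_measurable M A f" "set_borel_measurable M A g"
  shows "set_borel_measurable M A (\<lambda>z. f z + g z)"
  using borel_measurable_add[OF assms[unfolded set_borel_measurable_def]]
  by (simp add: set_borel_measurable_def scaleR_add_right)

lemma set_borel_measurable_times:
  fixes f g :: "complex \<Rightarrow> complex"
  assumes "set_borel_measurable M A f" "set_borel_measurable M A g"
  shows "set_borel_measurable M A (\<lambda>z. f z * g z)"
proof -
  have "(\<lambda>z. indicator A z *\<^sub>R (f z * g z)) = (\<lambda>z. (indicator A z *\<^sub>R f z) * (indicator A z *\<^sub>R g z))"
    by (auto simp: indicator_def)
  then show ?thesis
    using borel_measurable_times[OF assms[unfolded set_borel_measurable_def]]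
    by (simp add: set_borel_measurable_def)
qed

text \<open>The factor 2 comes from \<open>|x + y|^2 \<le> 2 |x|^2 + 2 |y|^2\<close> and stands in
  for the triangle inequality of the norm; only the existence of some bound matters for the inverse
  operators.\<close>

lemma sqint_add:
  assumes f: "sqint f" and g: "sqint g"
  shows "sqint (\<lambda>z. f z + g z)" "(L2_norm (\<lambda>z. f z + g z))\<^sup>2 \<le> 2 * (L2_norm f)\<^sup>2 + 2 * (L2_norm g)\<^sup>2"
proof -
  let ?B = "\<lambda>z. 2 * (cmod (f z))\<^sup>2 + 2 * (cmod (g z))\<^sup>2"
  have fi: "set_integrable lborel disk (\<lambda>z. 2 * (cmod (f z))\<^sup>2)"
    and gi: "set_integrable lborel disk (\<lambda>z. 2 * (cmod (g z))\<^sup>2)"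
    using f g by (auto simp: sqint_def)
  note * = sqint_bound[of "\<lambda>z. f z + g z" ?B, OF _ _ cmod_add_square_le]
  show "sqint (\<lambda>z. f z + g z)"
    using f g fi gi by (intro *) (auto simp: sqint_def intro!: set_borel_measurable_add set_integral_add)
  have "(L2_norm (\<lambda>z. f z + g z))\<^sup>2 \<le> (LINT z:disk|lborel. ?B z) / pi"
    using f g fi gi by (intro *) (auto simp: sqint_def intro!: set_borel_measurable_add set_integral_add)
  also have "\<dots> = 2 * (L2_norm f)\<^sup>2 + 2 * (L2_norm g)\<^sup>2"
    using fi gi by (simp add: set_integral_add L2_norm_power2 add_divide_distrib)
  finally show "(L2_norm (\<lambda>z. f z + g z))\<^sup>2 \<le> 2 * (L2_norm f)\<^sup>2 + 2 * (L2_norm g)\<^sup>2" .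
qed

lemma sqint_mult:
  assumes \<phi>: "set_borel_measurable lborel disk \<phi>" and M: "\<And>z. z \<in> disk \<Longrightarrow> cmod (\<phi> z) \<le> M" and f: "sqint f"
  shows "sqint (\<lambda>z. \<phi> z * f z)" "(L2_norm (\<lambda>z. \<phi> z * f z))\<^sup>2 \<le> M\<^sup>2 * (L2_norm f)\<^sup>2"
proof -
  let ?B = "\<lambda>z. M\<^sup>2 * (cmod (f z))\<^sup>2"
  have b: "(cmod (\<phi> z * f z))\<^sup>2 \<le> ?B z" if "z \<in> disk" for z
    using M[OF that] by (simp add: norm_mult power_mult_distrib mult_right_mono power_mono)
  have fi: "set_integrable lborel disk ?B" using f by (auto simp: sqint_def)
  have m: "set_borel_measurable lborel disk (\<lambda>z. \<phi> z * f z)"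
    using f by (auto simp: sqint_def intro!: set_borel_measurable_times \<phi>)
  show "sqint (\<lambda>z. \<phi> z * f z)" by (rule sqint_bound(1)[OF m fi b])
  have "(L2_norm (\<lambda>z. \<phi> z * f z))\<^sup>2 \<le> (LINT z:disk|lborel. ?B z) / pi" by (rule sqint_bound(2)[OF m fi b])
  also have "\<dots> = M\<^sup>2 * (L2_norm f)\<^sup>2" by (simp add: L2_norm_power2)
  finally show "(L2_norm (\<lambda>z. \<phi> z * f z))\<^sup>2 \<le> M\<^sup>2 * (L2_norm f)\<^sup>2" .
qed

lemma sqint_cmult: "sqint f \<Longrightarrow> sqint (\<lambda>z. c * f z)"
  by (rule sqint_mult(1)[where M="cmod c"]) (auto intro!: borel_measurable_disk_holomorphic)

lemma sqint_diff: "sqint f \<Longrightarrow> sqint g \<Longrightarrow> sqint (\<lambda>z. f z - g z)"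
  using sqint_add(1)[of f "\<lambda>z. (-1) * g z"] sqint_cmult[of g "-1"] by simp

lemma sqint_inner_integrable:
  assumes f: "sqint f" and g: "sqint g"
  shows "set_integrable lborel disk (\<lambda>z. f z * cnj (g z))"
proof -
  have "integrable lborel (\<lambda>z. indicator disk z *\<^sub>R ((cmod (f z))\<^sup>2 + (cmod (g z))\<^sup>2))"
    using f g set_integral_add(1)[of lborel disk "\<lambda>z. (cmod (f z))\<^sup>2" "\<lambda>z. (cmod (g z))\<^sup>2"]
    by (simp add: sqint_def set_integrable_def)
  moreover have "set_borel_measurable lborel disk (\<lambda>z. cnj (g z))"
  proof -
    have "(\<lambda>z. cnj (indicator disk z *\<^sub>R g z)) \<in> borel_measurable lborel"
      using g by (intro measurable_compose[OF _ borel_measurable_continuous_onI[OF continuous_on_cnj[OF continuous_on_id]]])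
         (auto simp: sqint_def set_borel_measurable_def)
    then show ?thesis by (simp add: set_borel_measurable_def)
  qed
  then have "(\<lambda>z. indicator disk z *\<^sub>R (f z * cnj (g z))) \<in> borel_measurable lborel"
    using f set_borel_measurable_times by (auto simp: sqint_def set_borel_measurable_def)
  moreover have "cmod (f z * cnj (g z)) \<le> (cmod (f z))\<^sup>2 + (cmod (g z))\<^sup>2" for z
  proof -
    have "2 * (cmod (f z) * cmod (g z)) \<le> (cmod (f z))\<^sup>2 + (cmod (g z))\<^sup>2"
      using sum_squares_bound[of "cmod (f z)" "cmod (g z)"] by simp
    moreover have "0 \<le> cmod (f z) * cmod (g z)" by simp
    ultimately have "cmod (f z) * cmod (g z) \<le> (cmod (f z))\<^sup>2 + (cmod (g z))\<^sup>2" by linarith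
    then show ?thesis by (simp add: norm_mult)
  qed
  ultimately show ?thesis
    unfolding set_integrable_def
    by (elim Bochner_Integration.integrable_bound) (auto intro!: AE_I2 simp: indicator_def)
qed

lemma L2_inner_diff_left:
  assumes "sqint f" "sqint g" "sqint k"
  shows "L2_inner (\<lambda>z. f z - g z) k = L2_inner f k - L2_inner g k"
  unfolding L2_inner_def dA_integral_def left_diff_distrib
  by (subst set_integral_diff) (auto intro!: sqint_inner_integrable assms simp: algebra_simps)

lemma L2_inner_self: "L2_inner f f = complex_of_real ((L2_norm f)\<^sup>2)"
proof -
  have "(LINT z:disk|lborel. f z * cnj (f z)) = complex_of_real (LINT z:disk|lborel. (cmod (f z))\<^sup>2)"
    unfolding set_lebesgue_integral_def
    by (subst integral_complex_of_real[symmetric], intro Bochner_Integration.integral_cong)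
      (auto simp: indicator_def complex_norm_square simp del: of_real_power)
  then show ?thesis by (simp add: L2_inner_def dA_integral_def L2_norm_power2)
qed

text \<open>The norm formula makes every Taylor coefficient vanish. The convention that elements of
  \<open>bergman\<close> are zero off the disk turns this into equality of functions, as uniqueness
  in a definite description requires.\<close>

lemma bergman_L2_norm_eq_0:
  assumes f: "f \<in> bergman" and 0: "L2_norm f = 0"
  shows "f = (\<lambda>z. 0)"
proof -
  obtain a where a: "pser a f" using f holomorphic_imp_pser by (auto simp: bergman_def)
  have sm: "summable (\<lambda>n. (cmod (a n))\<^sup>2 / (real n + 1))"
    using pser_integrable_disk_iff[OF a] f by (simp add: bergman_def)
  from pser_L2_norm_sums[OF a sm] 0 have "(\<lambda>n. (cmod (a n))\<^sup>2 / (real n + 1)) sums 0" by simp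
  then have "(cmod (a n))\<^sup>2 / (real n + 1) = 0" for n
    using suminf_eq_zero_iff[OF sm] by (simp add: sums_iff)
  then have "a n = 0" for n using of_nat_0_le_iff[of n, where 'a=real] by (auto simp: divide_eq_0_iff dest: spec[of _ n])
  then have "f z = 0" if "z \<in> disk" for z
    using a that sums_unique[of "\<lambda>n. a n * z ^ n" "f z"] by (simp add: pser_def)
  then show ?thesis using f by (auto simp: bergman_def)
qed

lemma bergman_lincomb:
  assumes "f \<in> bergman" "g \<in> bergman"
  shows "(\<lambda>z. a * f z + b * g z) \<in> bergman"
  using assms sqint_add(1)[OF sqint_cmult[of f a] sqint_cmult[of g b]]
  by (auto simp: bergman_iff intro!: holomorphic_intros)

lemma bergman_diff: "f \<in> bergman \<Longrightarrow> g \<in> bergman \<Longrightarrow> (\<lambda>z. f z - g z) \<in> bergman"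
  using bergman_lincomb[of f g 1 "-1"] by simp

text \<open>Any candidate with orthogonal remainder is the projection, since the difference of two
  candidates is orthogonal to itself. Existence of the projection is thus settled case by case, by
  exhibiting it.\<close>

lemma bergman_proj_eqI:
  assumes g: "sqint g" and h: "h \<in> bergman" and ort: "\<And>k. k \<in> bergman \<Longrightarrow> L2_inner (\<lambda>z. g z - h z) k = 0"
  shows "bergman_proj g = h"
  unfolding bergman_proj_def
proof (rule the_equality)
  show "h \<in> bergman \<and> (\<forall>k\<in>bergman. L2_inner (\<lambda>z. g z - h z) k = 0)" using h ort by blast
next
  fix h' assume h': "h' \<in> bergman \<and> (\<forall>k\<in>bergman. L2_inner (\<lambda>z. g z - h' z) k = 0)"
  let ?d = "\<lambda>z. h z - h' z"
  have d: "?d \<in> bergman" using h h' by (auto intro: bergman_diff)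
  have sq: "sqint h" "sqint h'" "sqint ?d" using h h' d by (auto simp: bergman_iff)
  have "L2_inner ?d ?d = L2_inner (\<lambda>z. (g z - h' z) - (g z - h z)) ?d" by simp
  also have "\<dots> = L2_inner (\<lambda>z. g z - h' z) ?d - L2_inner (\<lambda>z. g z - h z) ?d"
    using sq g by (intro L2_inner_diff_left sqint_diff)
  also have "\<dots> = 0" using h' ort d by simp
  finally have "L2_norm ?d = 0" by (simp add: L2_inner_self)
  then have "?d = (\<lambda>z. 0)" by (rule bergman_L2_norm_eq_0[OF d])
  then show "h' = h" by (auto simp: fun_eq_iff)
qed

section \<open>Toeplitz operators with symbol \<open>cnj z + p\<close>\<close>

lemma pser_unique_fun: "pser c f \<Longrightarrow> pser c g \<Longrightarrow> z \<in> disk \<Longrightarrow> f z = g z"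
  by (auto simp: pser_def intro: sums_unique2)

lemma pser_add: "pser a f \<Longrightarrow> pser b g \<Longrightarrow> pser (\<lambda>n. a n + b n) (\<lambda>z. f z + g z)"
  by (auto simp: pser_def distrib_right intro!: sums_add)

lemma pser_cmult: "pser a f \<Longrightarrow> pser (\<lambda>n. c * a n) (\<lambda>z. c * f z)"
  by (auto simp: pser_def mult.assoc intro!: sums_mult)

lemma pser_mult_id: "pser a f \<Longrightarrow> pser (case_nat 0 a) (\<lambda>z. z * f z)"
proof (unfold pser_def, intro ballI)
  fix z assume "\<forall>z\<in>disk. (\<lambda>n. a n * z ^ n) sums f z" "z \<in> disk"
  then have "(\<lambda>n. z * (a n * z ^ n)) sums (z * f z)" by (intro sums_mult) auto
  then have "(\<lambda>n. case_nat 0 a (Suc n) * z ^ Suc n) sums (z * f z)" by (simp add: mult_ac)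
  then show "(\<lambda>n. case_nat 0 a n * z ^ n) sums (z * f z)" by (subst (asm) sums_Suc_iff) simp
qed

lemma pser_deriv:
  assumes "pser c g"
  shows "pser (\<lambda>n. of_nat (Suc n) * c (Suc n)) (deriv g)"
proof (unfold pser_def, intro ballI)
  fix z assume z: "z \<in> disk"
  have sm: "summable (\<lambda>n. c n * w ^ n)" if "norm w < 1" for w
    using pserD[OF assms that] by (simp add: sums_iff)
  have "((\<lambda>x. \<Sum>n. c n * x ^ n) has_field_derivative (\<Sum>n. diffs c n * z ^ n)) (at z)"
    by (rule termdiffs_strong'[where K=1]) (use sm z in \<open>auto simp: disk_def\<close>)
  then have "(g has_field_derivative (\<Sum>n. diffs c n * z ^ n)) (at z)"
  proof (rule has_field_derivative_transform_within_open[where S=disk])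
    show "(\<Sum>n. c n * x ^ n) = g x" if "x \<in> disk" for x
      using assms that by (simp add: pser_def sums_iff)
  qed (use z in \<open>auto simp: disk_def\<close>)
  then have "deriv g z = (\<Sum>n. diffs c n * z ^ n)" by (rule DERIV_imp_deriv)
  moreover have "summable (\<lambda>n. diffs c n * z ^ n)"
    by (rule termdiff_converges[where K=1]) (use sm z in \<open>auto simp: disk_def\<close>)
  ultimately show "(\<lambda>n. of_nat (Suc n) * c (Suc n) * z ^ n) sums deriv g z"
    by (simp add: sums_iff diffs_def)
qed

lemma pser_euler:
  assumes c: "pser c g"
  shows "pser (\<lambda>n. of_nat (Suc n) * c n) (\<lambda>z. g z + z * deriv g z)"
proof -
  have "(\<lambda>n. c n + case_nat 0 (\<lambda>n. of_nat (Suc n) * c (Suc n)) n) = (\<lambda>n. of_nat (Suc n) * c n)"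
    by (auto simp: fun_eq_iff algebra_simps split: nat.splits)
  with pser_add[OF c pser_mult_id[OF pser_deriv[OF c]]] show ?thesis by simp
qed

lemma pser_exists:
  assumes "\<And>z. cmod z < 1 \<Longrightarrow> summable (\<lambda>n. c n * z ^ n)"
  shows "pser c (\<lambda>z. \<Sum>n. c n * z ^ n)"
  using assms by (auto simp: pser_def disk_def summable_sums)

text \<open>The passage from \<open>g\<close> to \<open>(z g)'\<close> multiplies the
  \<open>n\<close>-th coefficient by \<open>n + 1\<close>; dividing by \<open>n + 1\<close> inverts
  it without shrinking the disk of convergence.\<close>

lemma holomorphic_disk_euler_antideriv:
  assumes "f holomorphic_on disk"
  obtains g where "g holomorphic_on disk" "\<And>z. z \<in> disk \<Longrightarrow> f z = g z + z * deriv g z"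
proof -
  obtain a where a: "pser a f" using holomorphic_imp_pser[OF assms] .
  let ?c = "\<lambda>n. a n / of_nat (Suc n)"
  have sm: "summable (\<lambda>n. ?c n * z ^ n)" if "cmod z < 1" for z
  proof (rule summable_comparison_test'[OF pser_summable_norm[OF a _ that]])
    fix n
    have "cmod (?c n) \<le> cmod (a n)"
      using divide_left_mono[of 1 "real (Suc n)" "cmod (a n)"]
      by (simp only: norm_divide norm_of_nat) simp
    then show "cmod (?c n * z ^ n) \<le> cmod (a n) * cmod z ^ n"
      unfolding norm_mult norm_power by (intro mult_right_mono) auto
  qed auto
  let ?g = "\<lambda>z. \<Sum>n. ?c n * z ^ n"
  have g: "pser ?c ?g" by (rule pser_exists[OF sm])
  show thesis
  proof
    show "?g holomorphic_on disk" by (rule pser_holomorphic[OF g])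
    show "f z = ?g z + z * deriv ?g z" if "z \<in> disk" for z
      using pser_unique_fun[OF a _ that] pser_euler[OF g] by (simp del: of_nat_Suc)
  qed
qed

section \<open>The projection of \<open>cnj z * f\<close>\<close>

lemma set_integral_ball_exhaust_disk:
  fixes F :: "complex \<Rightarrow> complex"
  assumes "set_integrable lborel disk F"
  shows "(\<lambda>i. LINT z:ball 0 (1 - inverse (real (Suc i)))|lborel. F z) \<longlonglongrightarrow> (LINT z:disk|lborel. F z)"
proof -
  let ?A = "\<lambda>i. ball (0::complex) (1 - inverse (real (Suc i)))"
  have un: "(\<Union>i. ?A i) = disk"
  proof
    show "disk \<subseteq> (\<Union>i. ?A i)"
    proof
      fix z assume "z \<in> disk"
      then have "0 < 1 - cmod z" by (simp add: disk_def)
      then obtain i where "inverse (real (Suc i)) < 1 - cmod z" using reals_Archimedean by blast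
      then have "z \<in> ?A i" by simp
      then show "z \<in> (\<Union>i. ?A i)" by blast
    qed
  next
    show "(\<Union>i. ?A i) \<subseteq> disk"
      unfolding disk_def by (intro UN_least subset_ball) auto
  qed
  have "incseq ?A"
    by (intro incseq_SucI) (auto simp: field_simps intro!: subset_ball)
  then show ?thesis
    using set_integral_cont_up[of ?A lborel F] assms unfolding un by simp
qed

text \<open>Moving \<open>cnj z\<close> to the other factor turns the left side into the pairing of
  \<open>f\<close> with \<open>z k\<close>. In Parseval's formula on a ball of radius
  \<open>\<rho>\<close> the factors \<open>n + 2\<close> and \<open>n + 1\<close> cancel against the
  weights, and the two pairings agree up to the factor \<open>\<rho>^2\<close>, which tends to
  1.\<close>

lemma conj_toeplitz_orthogonality:
  assumes g: "g holomorphic_on disk" and f: "sqint f" "\<And>z. z \<in> disk \<Longrightarrow> f z = g z + z * deriv g z"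
    and g': "sqint (deriv g)" and k: "k \<in> bergman"
  shows "L2_inner (\<lambda>z. cnj z * f z) k = L2_inner (deriv g) k"
proof -
  obtain c where c: "pser c g" using holomorphic_imp_pser[OF g] .
  have kh: "k holomorphic_on disk" "sqint k" using k by (auto simp: bergman_iff)
  obtain b where b: "pser b k" using holomorphic_imp_pser[OF kh(1)] .
  have fp: "pser (\<lambda>n. of_nat (Suc n) * c n) f"
    using pser_euler[OF c] f(2) by (simp add: pser_def)
  let ?\<rho> = "\<lambda>i. 1 - inverse (real (Suc i))"
  let ?J1 = "\<lambda>i. LINT z:ball 0 (?\<rho> i)|lborel. cnj z * f z * cnj (k z)"
  let ?J2 = "\<lambda>i. LINT z:ball 0 (?\<rho> i)|lborel. deriv g z * cnj (k z)"
  have eq: "?J1 i = complex_of_real ((?\<rho> i)\<^sup>2) * ?J2 i" for i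
  proof -
    define \<rho> where "\<rho> = ?\<rho> i"
    have \<rho>: "0 \<le> \<rho>" "\<rho> < 1" by (auto simp: \<rho>_def field_simps)
    let ?w = "\<lambda>n. complex_of_real (pi * \<rho> ^ (2 * n + 2) / (real n + 1))"
    have "(\<lambda>n. of_nat (Suc n) * c n * cnj (case_nat 0 b n) * ?w n) sums (LINT z:ball 0 \<rho>|lborel. f z * cnj (z * k z))"
      by (rule pser_parseval_ball[OF fp pser_mult_id[OF b] \<rho>])
    \<comment> \<open>The constant coefficient of \<open>z * k z\<close> is 0, so the series may be
      started one index later.\<close>
    then have "(\<lambda>n. of_nat (Suc (Suc n)) * c (Suc n) * cnj (b n) * ?w (Suc n)) sums (LINT z:ball 0 \<rho>|lborel. f z * cnj (z * k z))"
      using sums_Suc_iff[of "\<lambda>n. of_nat (Suc n) * c n * cnj (case_nat 0 b n) * ?w n"] by simp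
    moreover have "of_nat (Suc (Suc n)) * c (Suc n) * cnj (b n) * ?w (Suc n) =
        complex_of_real (\<rho>\<^sup>2) * (of_nat (Suc n) * c (Suc n) * cnj (b n) * ?w n)" for n
    proof -
      have w: "of_nat (Suc m) * ?w m = complex_of_real (pi * \<rho> ^ (2 * m + 2))" for m
      proof -
        have "?w m = complex_of_real (pi * \<rho> ^ (2 * m + 2)) / of_nat (Suc m)" by (simp add: add.commute)
        then show ?thesis by (metis nonzero_mult_div_cancel_left of_nat_neq_0 times_divide_eq_right)
      qed
      have "of_nat (Suc (Suc n)) * c (Suc n) * cnj (b n) * ?w (Suc n) = c (Suc n) * cnj (b n) * (of_nat (Suc (Suc n)) * ?w (Suc n))"
        by (simp only: mult_ac)
      also have "\<dots> = c (Suc n) * cnj (b n) * (complex_of_real (\<rho>\<^sup>2) * complex_of_real (pi * \<rho> ^ (2 * n + 2)))"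
        unfolding w by (simp add: power2_eq_square)
      also have "\<dots> = c (Suc n) * cnj (b n) * (complex_of_real (\<rho>\<^sup>2) * (of_nat (Suc n) * ?w n))"
        by (simp only: w)
      finally show ?thesis by (simp only: mult_ac)
    qed
    ultimately have "(\<lambda>n. complex_of_real (\<rho>\<^sup>2) * (of_nat (Suc n) * c (Suc n) * cnj (b n) * ?w n))
        sums (LINT z:ball 0 \<rho>|lborel. f z * cnj (z * k z))" by simp
    moreover have "(\<lambda>n. complex_of_real (\<rho>\<^sup>2) * (of_nat (Suc n) * c (Suc n) * cnj (b n) * ?w n))
        sums (complex_of_real (\<rho>\<^sup>2) * (LINT z:ball 0 \<rho>|lborel. deriv g z * cnj (k z)))"
      by (rule sums_mult[OF pser_parseval_ball[OF pser_deriv[OF c] b \<rho>]])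
    ultimately have "(LINT z:ball 0 \<rho>|lborel. f z * cnj (z * k z)) =
        complex_of_real (\<rho>\<^sup>2) * (LINT z:ball 0 \<rho>|lborel. deriv g z * cnj (k z))"
      by (rule sums_unique2)
    then show ?thesis by (simp only: \<rho>_def complex_cnj_mult mult_ac)
  qed
  have "sqint (\<lambda>z. cnj z * f z)"
    by (rule sqint_mult(1)[where M=1])
      (use f in \<open>auto simp: disk_def set_borel_measurable_def intro!: borel_measurable_continuous_on_indicator continuous_intros\<close>)
  then have "?J1 \<longlonglongrightarrow> (LINT z:disk|lborel. cnj z * f z * cnj (k z))"
    by (intro set_integral_ball_exhaust_disk sqint_inner_integrable kh)
  moreover have "(\<lambda>i. complex_of_real ((?\<rho> i)\<^sup>2) * ?J2 i) \<longlonglongrightarrow>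
      complex_of_real ((1 - 0)\<^sup>2) * (LINT z:disk|lborel. deriv g z * cnj (k z))"
    by (intro tendsto_mult set_integral_ball_exhaust_disk sqint_inner_integrable g' kh tendsto_of_real
        tendsto_power tendsto_diff tendsto_const LIMSEQ_inverse_real_of_nat)
  ultimately have "(LINT z:disk|lborel. cnj z * f z * cnj (k z)) = (LINT z:disk|lborel. deriv g z * cnj (k z))"
    unfolding eq using LIMSEQ_unique by fastforce
  then show ?thesis by (simp add: L2_inner_def dA_integral_def)
qed

text \<open>The coefficient \<open>c (n + 1)\<close> enters \<open>deriv g\<close> with the factor
  \<open>n + 1\<close> and \<open>f\<close> with the factor \<open>n + 2\<close>. After the weights,
  \<open>n + 1\<close> is compared with \<open>n + 2\<close>, so the norm series of \<open>f\<close>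
  without its first term dominates.\<close>

lemma sqint_deriv_euler:
  assumes g: "g holomorphic_on disk" and f: "sqint f" "\<And>z. z \<in> disk \<Longrightarrow> f z = g z + z * deriv g z"
  shows "sqint (deriv g)"
proof -
  obtain c where c: "pser c g" using holomorphic_imp_pser[OF g] .
  have fp: "pser (\<lambda>n. of_nat (Suc n) * c n) f"
    using pser_euler[OF c] f(2) by (simp add: pser_def)
  have "summable (\<lambda>n. (cmod (of_nat (Suc n) * c n))\<^sup>2 / (real n + 1))"
    using pser_integrable_disk_iff[OF fp] f(1) by (simp add: sqint_def)
  then have sm: "summable (\<lambda>n. 2 * ((cmod (of_nat (Suc (Suc n)) * c (Suc n)))\<^sup>2 / (real (Suc n) + 1)))"
    by (intro summable_mult) (subst summable_Suc_iff)
  have "summable (\<lambda>n. (cmod (of_nat (Suc n) * c (Suc n)))\<^sup>2 / (real n + 1))"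
  proof (rule summable_comparison_test'[OF sm])
    fix n
    let ?x = "(cmod (c (Suc n)))\<^sup>2"
    have "(real n + 1)\<^sup>2 / (real n + 1) \<le> 2 * ((real n + 2)\<^sup>2 / (real n + 2))"
      by (simp add: power2_eq_square)
    then have "?x * ((real n + 1)\<^sup>2 / (real n + 1)) \<le> ?x * (2 * ((real n + 2)\<^sup>2 / (real n + 2)))"
      by (rule mult_left_mono) auto
    then show "norm ((cmod (of_nat (Suc n) * c (Suc n)))\<^sup>2 / (real n + 1)) \<le>
        2 * ((cmod (of_nat (Suc (Suc n)) * c (Suc n)))\<^sup>2 / (real (Suc n) + 1))"
      by (simp add: norm_mult power_mult_distrib algebra_simps del: of_nat_Suc) (simp add: algebra_simps)
  qed
  then show ?thesis
    using pser_integrable_disk_iff[OF pser_deriv[OF c]] borel_measurable_disk_holomorphic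
      holomorphic_deriv[OF g] by (simp add: sqint_def disk_def)
qed

lemma poly_bounded_disk: "\<exists>M. \<forall>z\<in>disk. cmod (poly p z) \<le> M"
proof -
  have "bounded (poly p ` cball 0 1)"
    by (intro compact_imp_bounded compact_continuous_image continuous_intros) auto
  then obtain M where "\<forall>x\<in>poly p ` cball 0 1. cmod x \<le> M" by (auto simp only: bounded_iff)
  then show ?thesis by (intro exI[of _ M]) (auto simp: disk_def)
qed

text \<open>The part \<open>poly p z * f z\<close> is already in the Bergman space, so only
  \<open>cnj z * f z - deriv g z\<close> has to be shown orthogonal to it. The case distinction
  supplies the representative that vanishes off the disk.\<close>

proposition toeplitz_conj_plus_poly:
  assumes g: "g holomorphic_on disk" and f: "f \<in> bergman" "\<And>z. z \<in> disk \<Longrightarrow> f z = g z + z * deriv g z"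
  shows "toeplitz (\<lambda>z. cnj z + poly p z) f = (\<lambda>z. if z \<in> disk then deriv g z + poly p z * f z else 0)" (is "_ = ?h")
    and "(\<lambda>z. if z \<in> disk then deriv g z + poly p z * f z else 0) \<in> bergman"
proof -
  have fs: "sqint f" "f holomorphic_on disk" using f by (auto simp: bergman_iff)
  have g's: "sqint (deriv g)" by (rule sqint_deriv_euler[OF g fs(1) f(2)])
  have g'h: "deriv g holomorphic_on disk" using g by (auto simp: disk_def intro: holomorphic_deriv)
  obtain M where M: "\<And>z. z \<in> disk \<Longrightarrow> cmod (poly p z) \<le> M" using poly_bounded_disk by blast
  have pf: "sqint (\<lambda>z. poly p z * f z)"
    by (rule sqint_mult(1)[OF borel_measurable_disk_holomorphic M fs(1)]) (auto intro!: holomorphic_intros)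
  have zf: "sqint (\<lambda>z. cnj z * f z)"
    by (rule sqint_mult(1)[where M=1])
      (use fs in \<open>auto simp: disk_def set_borel_measurable_def intro!: borel_measurable_continuous_on_indicator continuous_intros\<close>)
  have hs: "sqint (\<lambda>z. deriv g z + poly p z * f z)" by (rule sqint_add[OF g's pf])
  then have "sqint ?h" by (subst sqint_cong[of _ "\<lambda>z. deriv g z + poly p z * f z"]) auto
  moreover have "(\<lambda>z. deriv g z + poly p z * f z) holomorphic_on disk"
    by (intro holomorphic_intros g'h fs)
  then have "?h holomorphic_on disk" by (rule holomorphic_transform) auto
  ultimately show h: "?h \<in> bergman" by (simp add: bergman_iff)
  show "toeplitz (\<lambda>z. cnj z + poly p z) f = ?h"
    unfolding toeplitz_def
  proof (rule bergman_proj_eqI[OF _ h])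
    show "sqint (\<lambda>z. (cnj z + poly p z) * f z)"
      using sqint_add(1)[OF zf pf] by (simp add: distrib_right)
    fix k assume k: "k \<in> bergman"
    have "L2_inner (\<lambda>z. (cnj z + poly p z) * f z - ?h z) k = L2_inner (\<lambda>z. cnj z * f z - deriv g z) k"
      unfolding L2_inner_def dA_integral_def set_lebesgue_integral_def
      by (intro arg_cong[where f="\<lambda>x. _ * x"] Bochner_Integration.integral_cong)
        (auto simp: indicator_def algebra_simps)
    also have "\<dots> = L2_inner (\<lambda>z. cnj z * f z) k - L2_inner (deriv g) k"
      using k by (intro L2_inner_diff_left zf g's) (auto simp: bergman_iff)
    also have "\<dots> = 0" using conj_toeplitz_orthogonality[OF g fs(1) f(2) g's k] by simp
    finally show "L2_inner (\<lambda>z. (cnj z + poly p z) * f z - ?h z) k = 0" .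
  qed
qed

section \<open>The equation \<open>(z - a) u' - \<mu> u = h\<close>\<close>

text \<open>Only finitely many factors exceed \<open>\<theta>\<close>, and their total excess is one
  constant. The point is that \<open>K\<close> does not depend on the starting index
  \<open>m\<close>.\<close>

lemma prod_eventually_le_geometric:
  fixes x :: "nat \<Rightarrow> real"
  assumes nonneg: "\<And>n. 0 \<le> x n" and ev: "eventually (\<lambda>n. x n \<le> \<theta>) sequentially" and \<theta>: "0 < \<theta>"
  obtains K where "K \<ge> 0" "\<And>m j. (\<Prod>i<j. x (m + i)) \<le> K * \<theta> ^ j"
proof -
  obtain N where N: "\<And>n. n \<ge> N \<Longrightarrow> x n \<le> \<theta>" using ev by (auto simp: eventually_sequentially)
  \<comment> \<open>The excess of \<open>x n\<close> over \<open>\<theta>\<close>, cut off below at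
    1 so that extending a product over all \<open>k < N\<close> can only enlarge it.\<close>
  define y where "y = (\<lambda>n. max 1 (x n / \<theta>))"
  have y1: "1 \<le> y n" for n by (simp add: y_def)
  have yN: "y n = 1" if "n \<ge> N" for n using N[OF that] \<theta> by (simp add: y_def)
  have xy: "x n \<le> \<theta> * y n" for n using \<theta> by (auto simp: y_def max_def field_simps)
  define K where "K = (\<Prod>k<N. y k)"
  have "(\<Prod>i<j. x (m + i)) \<le> K * \<theta> ^ j" for m j
  proof -
    have "(\<Prod>i<j. x (m + i)) \<le> (\<Prod>i<j. \<theta> * y (m + i))"
      by (intro prod_mono conjI nonneg xy)
    also have "\<dots> = \<theta> ^ j * (\<Prod>i<j. y (m + i))" by (simp add: prod.distrib)
    also have "(\<Prod>i<j. y (m + i)) = (\<Prod>k\<in>{m..<m+j}. y k)"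
      by (rule prod.reindex_bij_witness[of _ "\<lambda>k. k - m" "\<lambda>i. m + i"]) auto
    also have "\<dots> = (\<Prod>k\<in>{m..<m+j} \<inter> {..<N}. y k)"
      by (rule prod.mono_neutral_right) (auto, meson not_le yN)
    also have "\<dots> \<le> (\<Prod>k<N. y k)"
      by (rule prod_mono2) (use y1 in \<open>auto intro: order.trans[OF zero_le_one]\<close>)
    finally show ?thesis using \<theta> by (simp add: K_def mult.commute mult_left_mono)
  qed
  moreover have "K \<ge> 0" unfolding K_def by (intro prod_nonneg ballI order.trans[OF zero_le_one y1])
  ultimately show thesis using that by blast
qed

text \<open>Cauchy-Schwarz after splitting the weight \<open>\<theta> ^ j\<close> into two factors
  \<open>sqrt \<theta> ^ j\<close>; the first of the resulting sums is geometric.\<close>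

lemma suminf_geometric_square_le:
  fixes y :: "nat \<Rightarrow> real"
  assumes \<theta>: "0 \<le> \<theta>" "\<theta> < 1" and y: "\<And>j. 0 \<le> y j" and s1: "summable (\<lambda>j. \<theta> ^ j * y j)" and s2: "summable (\<lambda>j. \<theta> ^ j * (y j)\<^sup>2)"
  shows "(\<Sum>j. \<theta> ^ j * y j)\<^sup>2 \<le> (\<Sum>j. \<theta> ^ j * (y j)\<^sup>2) / (1 - \<theta>)"
proof -
  define \<tau> where "\<tau> = sqrt \<theta>"
  have \<tau>: "\<tau> ^ j * \<tau> ^ j = \<theta> ^ j" for j using \<theta> by (simp add: \<tau>_def flip: power_mult_distrib)
  have "(\<Sum>j<n. \<theta> ^ j * y j)\<^sup>2 \<le> (\<Sum>j. \<theta> ^ j * (y j)\<^sup>2) / (1 - \<theta>)" for n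
  proof -
    have "(\<Sum>j<n. \<tau> ^ j * (\<tau> ^ j * y j))\<^sup>2 \<le> (\<Sum>j<n. (\<tau> ^ j)\<^sup>2) * (\<Sum>j<n. (\<tau> ^ j * y j)\<^sup>2)"
      by (rule Cauchy_Schwarz_ineq_sum)
    then have "(\<Sum>j<n. \<theta> ^ j * y j)\<^sup>2 \<le> (\<Sum>j<n. \<theta> ^ j) * (\<Sum>j<n. \<theta> ^ j * (y j)\<^sup>2)"
      by (simp add: \<tau> power_mult_distrib power2_eq_square[of "\<tau> ^ _"] flip: mult.assoc)
    also have "\<dots> \<le> (1 / (1 - \<theta>)) * (\<Sum>j. \<theta> ^ j * (y j)\<^sup>2)"
    proof (intro mult_mono)
      have "(\<Sum>j<n. \<theta> ^ j) \<le> (\<Sum>j. \<theta> ^ j)" by (intro sum_le_suminf) (use \<theta> in auto)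
      then show "(\<Sum>j<n. \<theta> ^ j) \<le> 1 / (1 - \<theta>)" using \<theta> by (simp add: suminf_geometric)
      show "(\<Sum>j<n. \<theta> ^ j * (y j)\<^sup>2) \<le> (\<Sum>j. \<theta> ^ j * (y j)\<^sup>2)"
        by (intro sum_le_suminf s2) (use \<theta> in auto)
    qed (use \<theta> in \<open>auto intro!: sum_nonneg\<close>)
    finally show ?thesis by simp
  qed
  moreover have "(\<lambda>n. (\<Sum>j<n. \<theta> ^ j * y j)\<^sup>2) \<longlonglongrightarrow> (\<Sum>j. \<theta> ^ j * y j)\<^sup>2"
    by (intro tendsto_power summable_LIMSEQ s1)
  ultimately show ?thesis by (intro LIMSEQ_le_const2) auto
qed

text \<open>A discrete convolution with a geometric kernel is bounded in the weighted norm.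
  Exchanging the sums moves the weight from index \<open>n\<close> to \<open>n + 1 + j\<close>,
  which costs at most a factor \<open>j + 2\<close>, and \<open>\<theta> ^ j\<close> absorbs
  it.\<close>

lemma summable_weighted_tail:
  fixes H :: "nat \<Rightarrow> complex"
  assumes \<theta>: "0 \<le> \<theta>" "\<theta> < 1" and H: "(\<lambda>n. (cmod (H n))\<^sup>2 / (real n + 1)) sums X"
  defines "L \<equiv> (\<Sum>j. \<theta> ^ j * (real j + 2))"
  shows "summable (\<lambda>j. \<theta> ^ j * (cmod (H (n + 1 + j)))\<^sup>2)"
    and "summable (\<lambda>j. \<theta> ^ j * cmod (H (n + 1 + j)))"
    and "(\<Sum>n<N. (\<Sum>j. \<theta> ^ j * (cmod (H (n + 1 + j)))\<^sup>2) / (real n + 1)) \<le> L * X"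
proof -
  have sL: "summable (\<lambda>j. \<theta> ^ j * (real j + 2))"
  proof -
    have "summable (\<lambda>j. of_nat (Suc j) * \<theta> ^ j + \<theta> ^ j)"
      using geometric_deriv_sums[of \<theta>] \<theta> by (intro summable_add summable_geometric) (auto simp: sums_iff)
    then show ?thesis by (simp add: algebra_simps)
  qed
  have X: "(\<Sum>m\<in>A. (cmod (H m))\<^sup>2 / (real m + 1)) \<le> X" if "finite A" for A
    using H that sum_le_suminf[of "\<lambda>n. (cmod (H n))\<^sup>2 / (real n + 1)" A] by (simp add: sums_iff)
  \<comment> \<open>Since \<open>n + j + 2 \<le> (j + 2) (n + 1)\<close>, this is the price of
    moving the weight by \<open>j + 1\<close> places.\<close>
  have shift: "(cmod (H (n + 1 + j)))\<^sup>2 / (real n + 1) \<le> (real j + 2) * ((cmod (H (n + 1 + j)))\<^sup>2 / (real (n + 1 + j) + 1))" for n j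
  proof -
    have "real n + real j + 2 \<le> (real j + 2) * (real n + 1)" by (simp add: algebra_simps)
    then have "1 / (real n + 1) \<le> (real j + 2) / (real (n + 1 + j) + 1)"
      by (simp add: divide_simps)
    from mult_left_mono[OF this, of "(cmod (H (n + 1 + j)))\<^sup>2"] show ?thesis by (simp add: mult_ac)
  qed
  have point: "\<theta> ^ j * (cmod (H (n + 1 + j)))\<^sup>2 \<le> (\<theta> ^ j * (real j + 2)) * ((real n + 1) * X)" for n j
  proof -
    have "(cmod (H (n + 1 + j)))\<^sup>2 / (real n + 1) \<le> (real j + 2) * X"
      using shift[of n j] X[of "{n + 1 + j}"] mult_left_mono[of _ X "real j + 2"] by fastforce
    then have "(cmod (H (n + 1 + j)))\<^sup>2 \<le> (real j + 2) * X * (real n + 1)"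
      by (simp add: divide_le_eq)
    from mult_left_mono[OF this, of "\<theta> ^ j"] show ?thesis using \<theta> by (simp add: mult_ac)
  qed
  show s2: "summable (\<lambda>j. \<theta> ^ j * (cmod (H (n + 1 + j)))\<^sup>2)" for n
    by (rule summable_comparison_test'[OF summable_mult2[OF sL, of "(real n + 1) * X"]])
      (use point[of _ n] \<theta> in auto)
  have "summable (\<lambda>j. \<theta> ^ j * (1 + (cmod (H (n + 1 + j)))\<^sup>2))"
    unfolding distrib_left using \<theta> by (intro summable_add s2) (auto intro: summable_geometric)
  then show "summable (\<lambda>j. \<theta> ^ j * cmod (H (n + 1 + j)))"
  proof (rule summable_comparison_test')
    fix j
    have "t \<le> 1 + t\<^sup>2" for t :: real
    proof -
      have "2 * t \<le> t\<^sup>2 + 1" using sum_squares_bound[of t 1] by simp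
      moreover have "0 \<le> t\<^sup>2" by simp
      ultimately show ?thesis by linarith
    qed
    then show "norm (\<theta> ^ j * cmod (H (n + 1 + j))) \<le> \<theta> ^ j * (1 + (cmod (H (n + 1 + j)))\<^sup>2)"
      using \<theta> by (simp add: mult_left_mono del: add_Suc_right)
  qed
  have "(\<Sum>n<N. (\<Sum>j. \<theta> ^ j * (cmod (H (n + 1 + j)))\<^sup>2) / (real n + 1)) =
      (\<Sum>n<N. \<Sum>j. \<theta> ^ j * (cmod (H (n + 1 + j)))\<^sup>2 / (real n + 1))"
    using s2 by (intro sum.cong) (auto simp: suminf_divide)
  also have "\<dots> = (\<Sum>j. \<Sum>n<N. \<theta> ^ j * (cmod (H (n + 1 + j)))\<^sup>2 / (real n + 1))"
    by (rule suminf_sum[symmetric]) (intro summable_divide s2)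
  also have "\<dots> \<le> (\<Sum>j. \<theta> ^ j * (real j + 2) * X)"
  proof (rule suminf_le)
    fix j
    have "(\<Sum>n<N. (cmod (H (n + 1 + j)))\<^sup>2 / (real n + 1)) \<le>
        (\<Sum>n<N. (real j + 2) * ((cmod (H (n + 1 + j)))\<^sup>2 / (real (n + 1 + j) + 1)))"
      by (intro sum_mono shift)
    also have "\<dots> = (real j + 2) * (\<Sum>n<N. (cmod (H (n + 1 + j)))\<^sup>2 / (real (n + 1 + j) + 1))"
      by (simp add: sum_distrib_left)
    also have "(\<Sum>n<N. (cmod (H (n + 1 + j)))\<^sup>2 / (real (n + 1 + j) + 1)) =
        (\<Sum>m\<in>(\<lambda>n. n + 1 + j) ` {..<N}. (cmod (H m))\<^sup>2 / (real m + 1))"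
      by (subst sum.reindex) (auto simp: inj_on_def)
    also have "(real j + 2) * \<dots> \<le> (real j + 2) * X" by (intro mult_left_mono X) auto
    finally have "\<theta> ^ j * (\<Sum>n<N. (cmod (H (n + 1 + j)))\<^sup>2 / (real n + 1)) \<le> \<theta> ^ j * ((real j + 2) * X)"
      using \<theta> by (intro mult_left_mono) auto
    then show "(\<Sum>n<N. \<theta> ^ j * (cmod (H (n + 1 + j)))\<^sup>2 / (real n + 1)) \<le> \<theta> ^ j * (real j + 2) * X"
      by (simp add: sum_distrib_left mult.assoc)
  qed (intro summable_sum summable_divide s2 summable_mult2 sL)+
  also have "\<dots> = L * X" unfolding L_def by (rule suminf_mult2[OF sL, symmetric])
  finally show "(\<Sum>n<N. (\<Sum>j. \<theta> ^ j * (cmod (H (n + 1 + j)))\<^sup>2) / (real n + 1)) \<le> L * X" .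
qed

text \<open>\<open>w\<close> stands for the coefficients of \<open>u'\<close> and \<open>H\<close>
  for those of the right-hand side. Solving for \<open>w (n + 1)\<close> would divide by
  \<open>a\<close> and amplify errors; solving for \<open>w n\<close> multiplies by \<open>a\<close>
  times a factor tending to 1. Iterating without end expresses \<open>w\<close> as a convergent
  series in the later values of \<open>H\<close>. The constant \<open>C\<close> is fixed before
  \<open>H\<close>, so it bounds an operator.\<close>

lemma backward_recursion_solution:
  fixes a \<mu> :: complex
  assumes a: "cmod a < 1" and \<mu>: "\<And>n. \<mu> \<noteq> of_nat n"
  obtains C where "C \<ge> 0"
    "\<And>H X. (\<lambda>n. (cmod (H n))\<^sup>2 / (real n + 1)) sums X \<Longrightarrow>
      \<exists>w Y. (\<forall>n. (of_nat (Suc n) - \<mu>) * w n = of_nat (Suc n) * (H (Suc n) + a * w (Suc n))) \<and>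
        (\<lambda>n. (cmod (w n))\<^sup>2 / (real n + 1)) sums Y \<and> Y \<le> C * X"
proof -
  define \<beta> :: "nat \<Rightarrow> complex" where "\<beta> = (\<lambda>m. of_nat m / (of_nat m - \<mu>))"
  \<comment> \<open>A contraction rate strictly between \<open>|a|\<close> and 1: as
    \<open>\<beta>\<close> tends to 1, \<open>|a * \<beta> m|\<close> is eventually at most
    \<open>\<theta>\<close>.\<close>
  define \<theta> where "\<theta> = (1 + cmod a) / 2"
  have \<theta>: "0 < \<theta>" "\<theta> < 1" "cmod a < \<theta>" using a norm_ge_zero[of a] by (auto simp: \<theta>_def field_simps intro: add_pos_nonneg)
  have \<beta>lim: "\<beta> \<longlonglongrightarrow> 1"
  proof -
    have "(\<lambda>m. inverse (1 - \<mu> * inverse (of_nat m))) \<longlonglongrightarrow> inverse (1 - \<mu> * 0)"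
      by (intro tendsto_intros lim_inverse_n) auto
    moreover have "eventually (\<lambda>m. inverse (1 - \<mu> * inverse (of_nat m)) = \<beta> m) sequentially"
      using eventually_gt_at_top[of 0]
      by eventually_elim (auto simp: \<beta>_def field_simps)
    ultimately show ?thesis by (auto dest: Lim_transform_eventually)
  qed
  obtain B where B: "\<And>m. cmod (\<beta> m) \<le> B" "B > 0"
    using convergent_imp_Bseq[OF convergentI[OF \<beta>lim]] by (auto simp: Bseq_def)
  have "(\<lambda>m. cmod (a * \<beta> m)) \<longlonglongrightarrow> cmod (a * 1)" by (intro tendsto_intros \<beta>lim)
  then have "eventually (\<lambda>m. cmod (a * \<beta> m) < \<theta>) sequentially"
    by (rule order_tendstoD) (use \<theta> in simp)
  then have "eventually (\<lambda>m. cmod (a * \<beta> m) \<le> \<theta>) sequentially"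
    by eventually_elim simp
  from prod_eventually_le_geometric[OF norm_ge_zero this \<theta>(1)]
  obtain K where K: "K \<ge> 0" "\<And>m j. (\<Prod>i<j. cmod (a * \<beta> (m + i))) \<le> K * \<theta> ^ j" by blast
  \<comment> \<open>The offset \<open>n + 2\<close> arises because \<open>s n\<close> calls
    \<open>w (n + 1) = \<beta> (n + 2) * s (n + 1)\<close>; \<open>P n j\<close> collects the
    factors of the first \<open>j\<close> such calls.\<close>
  define P where "P = (\<lambda>n j. \<Prod>i<j. a * \<beta> (n + 2 + i))"
  have Pb: "cmod (P n j) \<le> K * \<theta> ^ j" for n j
    using K(2)[of "n + 2" j] by (simp add: P_def prod_norm)
  define L where "L = (\<Sum>j. \<theta> ^ j * (real j + 2))"
  \<comment> \<open>\<open>B\<close> bounds \<open>\<beta>\<close>, \<open>K\<close> the products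
    \<open>P\<close>, \<open>1 / (1 - \<theta>)\<close> comes from Cauchy-Schwarz, and
    \<open>L\<close> from the exchange of sums.\<close>
  define C where "C = B\<^sup>2 * K\<^sup>2 / (1 - \<theta>) * L"
  have L0: "0 \<le> L"
  proof -
    have "summable (\<lambda>j. of_nat (Suc j) * \<theta> ^ j + \<theta> ^ j)"
      using geometric_deriv_sums[of \<theta>] \<theta> by (intro summable_add summable_geometric) (auto simp: sums_iff)
    then have "summable (\<lambda>j. \<theta> ^ j * (real j + 2))" by (simp add: algebra_simps)
    then show ?thesis unfolding L_def using \<theta> by (intro suminf_nonneg) auto
  qed
  show thesis
  proof (rule that[of C])
    show "C \<ge> 0" using \<theta> L0 by (simp add: C_def)
    fix H X assume H: "(\<lambda>n. (cmod (H n))\<^sup>2 / (real n + 1)) sums X"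
    note tail = summable_weighted_tail[OF less_imp_le[OF \<theta>(1)] \<theta>(2) H, folded L_def]
    have smn: "summable (\<lambda>j. cmod (P n j * H (n + 1 + j)))" for n
    proof (rule summable_comparison_test'[OF summable_mult[OF tail(2)[of n], of K]])
      show "norm (cmod (P n j * H (n + 1 + j))) \<le> K * (\<theta> ^ j * cmod (H (n + 1 + j)))" for j
        using mult_right_mono[OF Pb[of n j], of "cmod (H (n + 1 + j))"] by (simp add: norm_mult mult.assoc)
    qed
    define s where "s = (\<lambda>n. \<Sum>j. P n j * H (n + 1 + j))"
    define w where "w = (\<lambda>n. \<beta> (Suc n) * s n)"
    have s: "s n = H (Suc n) + a * w (Suc n)" for n
    proof -
      have sm: "summable (\<lambda>j. P n j * H (n + 1 + j))" for n
        using smn[of n] by (rule summable_norm_cancel)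
      have PS: "P n (Suc j) = a * \<beta> (n + 2) * P (Suc n) j" for j
        unfolding P_def by (subst prod.lessThan_Suc_shift) simp
      have "s n = P n 0 * H (n + 1 + 0) + (\<Sum>j. P n (Suc j) * H (n + 1 + Suc j))"
        unfolding s_def using suminf_split_head[OF sm[of n]] by simp
      also have "(\<Sum>j. P n (Suc j) * H (n + 1 + Suc j)) = (\<Sum>j. a * \<beta> (n + 2) * (P (Suc n) j * H (Suc n + 1 + j)))"
        by (simp add: PS mult.assoc)
      also have "\<dots> = a * \<beta> (n + 2) * s (Suc n)"
        unfolding s_def by (rule suminf_mult[OF sm])
      finally show ?thesis by (simp add: P_def w_def mult.assoc)
    qed
    have rec: "(of_nat (Suc n) - \<mu>) * w n = of_nat (Suc n) * (H (Suc n) + a * w (Suc n))" for n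
    proof -
      have "of_nat (Suc n) - \<mu> \<noteq> 0" using \<mu>[of "Suc n"] by auto
      then have "(of_nat (Suc n) - \<mu>) * \<beta> (Suc n) = of_nat (Suc n)"
        unfolding \<beta>_def by (metis nonzero_mult_div_cancel_left times_divide_eq_right)
      then have "(of_nat (Suc n) - \<mu>) * w n = of_nat (Suc n) * s n"
        by (simp only: w_def mult.assoc[symmetric])
      then show ?thesis by (simp only: s)
    qed
    have wb: "(cmod (w n))\<^sup>2 \<le> B\<^sup>2 * K\<^sup>2 / (1 - \<theta>) * (\<Sum>j. \<theta> ^ j * (cmod (H (n + 1 + j)))\<^sup>2)" for n
    proof -
      have "cmod (s n) \<le> (\<Sum>j. cmod (P n j * H (n + 1 + j)))"
        unfolding s_def by (rule summable_norm[OF smn])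
      also have "\<dots> \<le> (\<Sum>j. K * (\<theta> ^ j * cmod (H (n + 1 + j))))"
      proof (rule suminf_le[OF _ smn summable_mult[OF tail(2)]])
        show "cmod (P n j * H (n + 1 + j)) \<le> K * (\<theta> ^ j * cmod (H (n + 1 + j)))" for j
          using mult_right_mono[OF Pb[of n j], of "cmod (H (n + 1 + j))"] by (simp add: norm_mult mult.assoc)
      qed
      also have "\<dots> = K * (\<Sum>j. \<theta> ^ j * cmod (H (n + 1 + j)))"
        by (rule suminf_mult[OF tail(2)])
      finally have sK: "cmod (s n) \<le> K * (\<Sum>j. \<theta> ^ j * cmod (H (n + 1 + j)))" .
      have "cmod (w n) \<le> B * (K * (\<Sum>j. \<theta> ^ j * cmod (H (n + 1 + j))))"
        unfolding w_def norm_mult using B by (intro mult_mono B sK) auto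
      then have "(cmod (w n))\<^sup>2 \<le> (B * (K * (\<Sum>j. \<theta> ^ j * cmod (H (n + 1 + j)))))\<^sup>2"
        by (intro power_mono) auto
      also have "\<dots> = B\<^sup>2 * K\<^sup>2 * (\<Sum>j. \<theta> ^ j * cmod (H (n + 1 + j)))\<^sup>2"
        by (simp add: power_mult_distrib)
      also have "\<dots> \<le> B\<^sup>2 * K\<^sup>2 * ((\<Sum>j. \<theta> ^ j * (cmod (H (n + 1 + j)))\<^sup>2) / (1 - \<theta>))"
        using \<theta> by (intro mult_left_mono suminf_geometric_square_le tail) auto
      finally show ?thesis by simp
    qed
    have part: "(\<Sum>n<N. (cmod (w n))\<^sup>2 / (real n + 1)) \<le> C * X" for N
    proof -
      have "(\<Sum>n<N. (cmod (w n))\<^sup>2 / (real n + 1)) \<le>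
          (\<Sum>n<N. B\<^sup>2 * K\<^sup>2 / (1 - \<theta>) * ((\<Sum>j. \<theta> ^ j * (cmod (H (n + 1 + j)))\<^sup>2) / (real n + 1)))"
        unfolding times_divide_eq_right by (intro sum_mono divide_right_mono wb[unfolded times_divide_eq_right]) auto
      also have "\<dots> = B\<^sup>2 * K\<^sup>2 / (1 - \<theta>) * (\<Sum>n<N. (\<Sum>j. \<theta> ^ j * (cmod (H (n + 1 + j)))\<^sup>2) / (real n + 1))"
        by (rule sum_distrib_left[symmetric])
      also have "\<dots> \<le> B\<^sup>2 * K\<^sup>2 / (1 - \<theta>) * (L * X)"
        using \<theta> by (intro mult_left_mono tail(3)) auto
      finally show ?thesis by (simp add: C_def)
    qed
    have sw: "summable (\<lambda>n. (cmod (w n))\<^sup>2 / (real n + 1))"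
      by (rule summableI_nonneg_bounded[OF _ part]) auto
    have "(\<Sum>n. (cmod (w n))\<^sup>2 / (real n + 1)) \<le> C * X"
      by (rule suminf_le_const[OF sw part])
    with rec sw show "\<exists>w Y. (\<forall>n. (of_nat (Suc n) - \<mu>) * w n = of_nat (Suc n) * (H (Suc n) + a * w (Suc n))) \<and>
        (\<lambda>n. (cmod (w n))\<^sup>2 / (real n + 1)) sums Y \<and> Y \<le> C * X"
      by (intro exI[of _ w] exI[of _ "\<Sum>n. (cmod (w n))\<^sup>2 / (real n + 1)"]) (auto simp: summable_sums)
  qed
qed

text \<open>Bounded terms already give \<open>|c n|^2 = O(n)\<close>, and this growth is harmless
  inside the unit disk.\<close>

lemma pser_of_summable_square:
  assumes "summable (\<lambda>n. (cmod (c n))\<^sup>2 / (real n + 1))"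
  shows "pser c (\<lambda>z. \<Sum>n. c n * z ^ n)"
proof (rule pser_exists)
  fix z :: complex assume z: "cmod z < 1"
  obtain X where X: "\<And>n. (cmod (c n))\<^sup>2 / (real n + 1) \<le> X"
    using summable_imp_Bseq[OF assms] by (auto simp: Bseq_def)
  have "summable (\<lambda>n. cmod z ^ n + X * (of_nat (Suc n) * cmod z ^ n))"
    using geometric_deriv_sums[of "cmod z"] z
    by (intro summable_add summable_mult summable_geometric) (auto simp: sums_iff)
  then show "summable (\<lambda>n. c n * z ^ n)"
  proof (rule summable_comparison_test')
    fix n
    have "2 * cmod (c n) \<le> (cmod (c n))\<^sup>2 + 1" using sum_squares_bound[of "cmod (c n)" 1] by simp
    moreover have "(cmod (c n))\<^sup>2 \<le> X * (real n + 1)" using X[of n] by (simp add: divide_le_eq)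
    ultimately have "cmod (c n) \<le> 1 + X * (real n + 1)"
      using norm_ge_zero[of "c n"] by linarith
    then have "cmod (c n) * cmod z ^ n \<le> (1 + X * (real n + 1)) * cmod z ^ n"
      by (intro mult_right_mono) auto
    then show "norm (c n * z ^ n) \<le> cmod z ^ n + X * (of_nat (Suc n) * cmod z ^ n)"
      by (simp add: norm_mult norm_power algebra_simps)
  qed
qed

lemma pser_sqint:
  assumes "pser c f" "summable (\<lambda>n. (cmod (c n))\<^sup>2 / (real n + 1))"
  shows "sqint f"
  using pser_integrable_disk_iff[OF assms(1)] assms(2)
    borel_measurable_disk_holomorphic[OF pser_holomorphic[OF assms(1)]] by (simp add: sqint_def)

text \<open>The backward recursion yields \<open>u'\<close>; the constant term of \<open>u\<close>
  is then read off from the equation. The derivative is bounded along with \<open>u\<close> because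
  \<open>f = (z g)'\<close> involves both.\<close>

lemma fuchs_equation_solution:
  fixes a \<mu> :: complex
  assumes a: "cmod a < 1" and \<mu>: "\<And>n. \<mu> \<noteq> of_nat n"
  obtains C where "C \<ge> 0"
    "\<And>h. h holomorphic_on disk \<Longrightarrow> sqint h \<Longrightarrow>
      \<exists>u. u holomorphic_on disk \<and> (\<forall>z\<in>disk. (z - a) * deriv u z - \<mu> * u z = h z) \<and>
        sqint u \<and> sqint (deriv u) \<and>
        (L2_norm u)\<^sup>2 \<le> C * (L2_norm h)\<^sup>2 \<and> (L2_norm (deriv u))\<^sup>2 \<le> C * (L2_norm h)\<^sup>2"
proof -
  have \<mu>0: "\<mu> \<noteq> 0" using \<mu>[of 0] by simp
  show thesis
  proof (rule backward_recursion_solution[OF a \<mu>])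
    fix C assume C: "C \<ge> 0" and sol: "\<And>H X. (\<lambda>n. (cmod (H n))\<^sup>2 / (real n + 1)) sums X \<Longrightarrow>
        \<exists>w Y. (\<forall>n. (of_nat (Suc n) - \<mu>) * w n = of_nat (Suc n) * (H (Suc n) + a * w (Suc n))) \<and>
          (\<lambda>n. (cmod (w n))\<^sup>2 / (real n + 1)) sums Y \<and> Y \<le> C * X"
    \<comment> \<open>The first summand pays for the constant coefficient of \<open>u\<close>, the
      second for all others and for \<open>deriv u\<close>.\<close>
    define C' where "C' = (2 + 2 * C) / (cmod \<mu>)\<^sup>2 + C"
    have C': "C \<le> C'" "0 \<le> C'" using C by (auto simp: C'_def)
    show thesis
    proof (rule that[of C'])
      show "C' \<ge> 0" by (rule C')
      fix h assume h: "h holomorphic_on disk" "sqint h"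
      obtain H where H: "pser H h" using holomorphic_imp_pser[OF h(1)] .
      have smH: "summable (\<lambda>n. (cmod (H n))\<^sup>2 / (real n + 1))"
        using pser_integrable_disk_iff[OF H] h(2) by (simp add: sqint_def)
      define X where "X = (L2_norm h)\<^sup>2"
      have HX: "(\<lambda>n. (cmod (H n))\<^sup>2 / (real n + 1)) sums X"
        unfolding X_def by (rule pser_L2_norm_sums[OF H smH])
      from sol[OF HX] obtain w Y where
        rec: "\<And>n. (of_nat (Suc n) - \<mu>) * w n = of_nat (Suc n) * (H (Suc n) + a * w (Suc n))"
        and w: "(\<lambda>n. (cmod (w n))\<^sup>2 / (real n + 1)) sums Y" and Y: "Y \<le> C * X" by blast
      \<comment> \<open>The constant coefficient solves the equation at order zero,
        \<open>- a * w 0 - \<mu> * c 0 = H 0\<close>, which uses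
        \<open>\<mu> \<noteq> 0\<close>.\<close>
      define c where "c = (\<lambda>n. case n of 0 \<Rightarrow> - (H 0 + a * w 0) / \<mu> | Suc m \<Rightarrow> w m / of_nat (Suc m))"
      have c0: "c 0 = - (H 0 + a * w 0) / \<mu>" and cS: "c (Suc m) = w m / of_nat (Suc m)" for m
        by (auto simp: c_def)
      have wc: "of_nat (Suc n) * c (Suc n) = w n" for n by (simp add: cS del: of_nat_Suc)
      have cle: "(cmod (c (Suc n)))\<^sup>2 / (real (Suc n) + 1) \<le> (cmod (w n))\<^sup>2 / (real n + 1)" for n
      proof -
        have "cmod (w n) / real (Suc n) \<le> cmod (w n) / 1" by (intro divide_left_mono) auto
        then have "cmod (c (Suc n)) \<le> cmod (w n)" unfolding cS norm_divide norm_of_nat by simp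
        then show ?thesis by (intro frac_le power_mono) auto
      qed
      have smc: "summable (\<lambda>n. (cmod (c (Suc n)))\<^sup>2 / (real (Suc n) + 1))"
        by (rule summable_comparison_test'[OF sums_summable[OF w]]) (use cle in auto)
      then have smc': "summable (\<lambda>n. (cmod (c n))\<^sup>2 / (real n + 1))"
        by (rule summable_Suc_iff[of "\<lambda>n. (cmod (c n))\<^sup>2 / (real n + 1)", THEN iffD1])
      define u where "u = (\<lambda>z. \<Sum>n. c n * z ^ n)"
      have u: "pser c u" unfolding u_def by (rule pser_of_summable_square[OF smc'])
      have u': "pser w (deriv u)" using pser_deriv[OF u] unfolding wc .
      have "pser (\<lambda>n. case_nat 0 w n + (- a) * w n + (- \<mu>) * c n) (\<lambda>z. z * deriv u z + (- a) * deriv u z + (- \<mu>) * u z)"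
        by (intro pser_add pser_mult_id pser_cmult u u')
      moreover have "case_nat 0 w n + (- a) * w n + (- \<mu>) * c n = H n" for n
      proof (cases n)
        case 0
        then show ?thesis using \<mu>0 by (simp add: c0)
      next
        case (Suc m)
        have nz: "(of_nat (Suc m) :: complex) \<noteq> 0" by (rule of_nat_neq_0)
        have "of_nat (Suc m) * (w m - a * w (Suc m) - \<mu> * c (Suc m)) = of_nat (Suc m) * w m - of_nat (Suc m) * (a * w (Suc m)) - \<mu> * (of_nat (Suc m) * c (Suc m))"
          by (simp only: right_diff_distrib mult_ac)
        also have "\<dots> = (of_nat (Suc m) - \<mu>) * w m - of_nat (Suc m) * (a * w (Suc m))"
          unfolding wc by (simp only: left_diff_distrib) simp
        also have "\<dots> = of_nat (Suc m) * H (Suc m)" unfolding rec by (simp only: distrib_left) simp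
        finally have "w m - a * w (Suc m) - \<mu> * c (Suc m) = H (Suc m)" using nz mult_left_cancel by blast
        then show ?thesis using Suc by simp
      qed
      ultimately have "pser H (\<lambda>z. z * deriv u z + (- a) * deriv u z + (- \<mu>) * u z)" by simp
      from pser_unique_fun[OF this H]
      have eq: "\<forall>z\<in>disk. (z - a) * deriv u z - \<mu> * u z = h z" by (simp add: algebra_simps)
      have nu': "(L2_norm (deriv u))\<^sup>2 = Y"
        using sums_unique2[OF pser_L2_norm_sums[OF u' sums_summable[OF w]] w] .
      have X0: "0 \<le> X" by (simp add: X_def)
      have nu: "(L2_norm u)\<^sup>2 \<le> C' * X"
      proof -
        have "(L2_norm u)\<^sup>2 = (\<Sum>n. (cmod (c n))\<^sup>2 / (real n + 1))"
          using pser_L2_norm_sums[OF u smc'] by (simp add: sums_iff)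
        also have "\<dots> = (cmod (c 0))\<^sup>2 + (\<Sum>n. (cmod (c (Suc n)))\<^sup>2 / (real (Suc n) + 1))"
          using suminf_split_head[OF smc'] by simp
        also have "(\<Sum>n. (cmod (c (Suc n)))\<^sup>2 / (real (Suc n) + 1)) \<le> Y"
          using suminf_le[OF cle smc sums_summable[OF w]] w by (simp add: sums_iff)
        also have "(cmod (c 0))\<^sup>2 \<le> (2 + 2 * C) * X / (cmod \<mu>)\<^sup>2"
        proof -
          have "(cmod (H 0))\<^sup>2 \<le> X"
            using sum_le_suminf[OF smH, of "{0}"] HX by (simp add: sums_iff)
          moreover have w0: "(cmod (w 0))\<^sup>2 \<le> Y"
            using sum_le_suminf[OF sums_summable[OF w], of "{0}"] w by (simp add: sums_iff)
          moreover have "(cmod (a * w 0))\<^sup>2 \<le> (cmod (w 0))\<^sup>2"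
            using a by (intro power_mono) (auto simp: norm_mult mult_left_le_one_le)
          moreover have "(cmod (H 0 + a * w 0))\<^sup>2 \<le> 2 * (cmod (H 0))\<^sup>2 + 2 * (cmod (a * w 0))\<^sup>2"
            by (rule cmod_add_square_le)
          ultimately have "(cmod (H 0 + a * w 0))\<^sup>2 \<le> 2 * X + 2 * (C * X)"
            using Y by linarith
          then have "(cmod (H 0 + a * w 0))\<^sup>2 \<le> (2 + 2 * C) * X" by (simp add: algebra_simps)
          moreover have "(cmod (c 0))\<^sup>2 = (cmod (H 0 + a * w 0))\<^sup>2 / (cmod \<mu>)\<^sup>2"
            unfolding c0 by (simp add: norm_divide norm_minus_cancel power_divide flip: minus_add_distrib)
          ultimately show ?thesis by (simp add: divide_right_mono)
        qed
        finally have "(L2_norm u)\<^sup>2 \<le> (2 + 2 * C) * X / (cmod \<mu>)\<^sup>2 + Y" by simp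
        then show ?thesis using Y by (simp add: C'_def algebra_simps)
      qed
      have "(L2_norm (deriv u))\<^sup>2 \<le> C' * X"
        using nu' Y mult_right_mono[OF C'(1) X0] by linarith
      then show "\<exists>u. u holomorphic_on disk \<and> (\<forall>z\<in>disk. (z - a) * deriv u z - \<mu> * u z = h z) \<and>
          sqint u \<and> sqint (deriv u) \<and>
          (L2_norm u)\<^sup>2 \<le> C' * (L2_norm h)\<^sup>2 \<and> (L2_norm (deriv u))\<^sup>2 \<le> C' * (L2_norm h)\<^sup>2"
        using eq nu pser_holomorphic[OF u] pser_sqint[OF u smc'] pser_sqint[OF u' sums_summable[OF w]]
        unfolding X_def by blast
    qed
  qed
qed

text \<open>Differentiating \<open>n\<close> times gives
  \<open>(z - a) u^(n+1) = (\<mu> - n) u^(n)\<close>. At \<open>z = a\<close> every derivative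
  vanishes because \<open>\<mu>\<close> is never \<open>n\<close>, and the identity theorem
  finishes.\<close>

lemma fuchs_equation_unique:
  fixes a \<mu> :: complex
  assumes a: "a \<in> disk" and \<mu>: "\<And>n. \<mu> \<noteq> of_nat n" and u: "u holomorphic_on disk"
    and eq: "\<And>z. z \<in> disk \<Longrightarrow> (z - a) * deriv u z - \<mu> * u z = 0"
    and z: "z \<in> disk"
  shows "u z = 0"
proof -
  have op: "open disk" "connected disk" by (auto simp: disk_def)
  have hol: "(deriv ^^ n) u holomorphic_on disk" for n
    by (rule holomorphic_higher_deriv[OF u op(1)])
  have der: "((deriv ^^ n) u has_field_derivative (deriv ^^ Suc n) u x) (at x)" if "x \<in> disk" for n x
    using holomorphic_derivI[OF hol op(1) that] by simp
  have eqn: "(x - a) * (deriv ^^ Suc n) u x = (\<mu> - of_nat n) * (deriv ^^ n) u x" if "x \<in> disk" for n x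
    using that
  proof (induction n arbitrary: x)
    case 0
    then show ?case using eq[of x] by simp
  next
    case (Suc n)
    have "((\<lambda>x. (x - a) * (deriv ^^ Suc n) u x) has_field_derivative
        (x - a) * (deriv ^^ Suc (Suc n)) u x + (deriv ^^ Suc n) u x) (at x)"
      by (rule derivative_eq_intros der Suc.prems refl | simp)+
    moreover have "((\<lambda>x. (x - a) * (deriv ^^ Suc n) u x) has_field_derivative
        (\<mu> - of_nat n) * (deriv ^^ Suc n) u x) (at x)"
    proof (rule has_field_derivative_transform_within_open[OF DERIV_cmult[OF der[OF Suc.prems]] op(1) Suc.prems])
      show "(\<mu> - of_nat n) * (deriv ^^ n) u y = (y - a) * (deriv ^^ Suc n) u y" if "y \<in> disk" for y
        using Suc.IH[OF that] by simp
    qed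
    ultimately have "(x - a) * (deriv ^^ Suc (Suc n)) u x + (deriv ^^ Suc n) u x = (\<mu> - of_nat n) * (deriv ^^ Suc n) u x"
      by (rule DERIV_unique)
    then show ?case by (simp add: algebra_simps)
  qed
  have 0: "(deriv ^^ n) u a = 0" for n
    using eqn[OF a, of n] \<mu>[of n] by simp
  then show ?thesis
    using holomorphic_fun_eq_0_on_connected[OF u op _ a z] 0[of 0] by simp
qed

section \<open>Symbols with a single zero in the disk\<close>

text \<open>The bounded solutions are picked by choice, with no linearity built in; injectivity
  makes them unique, and linearity of the inverse follows from that of \<open>A\<close>.\<close>

lemma bergman_invertibleI:
  assumes maps: "\<And>f. f \<in> bergman \<Longrightarrow> A f \<in> bergman"
    and lin: "\<And>f g a b. f \<in> bergman \<Longrightarrow> g \<in> bergman \<Longrightarrow> A (\<lambda>z. a * f z + b * g z) = (\<lambda>z. a * A f z + b * A g z)"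
    and inj: "\<And>f. f \<in> bergman \<Longrightarrow> A f = (\<lambda>z. 0) \<Longrightarrow> f = (\<lambda>z. 0)"
    and surj: "\<And>h. h \<in> bergman \<Longrightarrow> \<exists>f\<in>bergman. A f = h \<and> L2_norm f \<le> C * L2_norm h"
  shows "bergman_invertible A"
proof -
  have eqI: "f = g" if "f \<in> bergman" "g \<in> bergman" "A f = A g" for f g
  proof -
    have "A (\<lambda>z. 1 * f z + (-1) * g z) = (\<lambda>z. 0)"
      using lin[OF that(1,2), of 1 "-1"] that(3) by (simp add: fun_eq_iff)
    from inj[OF bergman_lincomb[OF that(1,2)] this] show ?thesis by (simp add: fun_eq_iff)
  qed
  define S where "S h = (SOME f. f \<in> bergman \<and> A f = h \<and> L2_norm f \<le> C * L2_norm h)" for h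
  have S: "S h \<in> bergman \<and> A (S h) = h \<and> L2_norm (S h) \<le> C * L2_norm h" if "h \<in> bergman" for h
  proof -
    have "\<exists>f. f \<in> bergman \<and> A f = h \<and> L2_norm f \<le> C * L2_norm h" using surj[OF that] by blast
    then show ?thesis unfolding S_def by (rule someI_ex)
  qed
  show ?thesis
    unfolding bergman_invertible_def
  proof (intro exI[of _ S] conjI ballI allI)
    fix f g a b assume fg: "f \<in> bergman" "g \<in> bergman"
    show "S (\<lambda>z. a * f z + b * g z) = (\<lambda>z. a * S f z + b * S g z)"
    proof (rule eqI)
      show "S (\<lambda>z. a * f z + b * g z) \<in> bergman" using S[OF bergman_lincomb[OF fg]] by blast
      show "(\<lambda>z. a * S f z + b * S g z) \<in> bergman" using S fg by (intro bergman_lincomb) blast+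
      have "A (S (\<lambda>z. a * f z + b * g z)) = (\<lambda>z. a * f z + b * g z)"
        using S[OF bergman_lincomb[OF fg]] by blast
      also have "\<dots> = (\<lambda>z. a * A (S f) z + b * A (S g) z)"
        using S[OF fg(1)] S[OF fg(2)] by simp
      also have "\<dots> = A (\<lambda>z. a * S f z + b * S g z)"
        using S[OF fg(1)] S[OF fg(2)] by (intro lin[symmetric]) blast+
      finally show "A (S (\<lambda>z. a * f z + b * g z)) = A (\<lambda>z. a * S f z + b * S g z)" .
    qed
  next
    fix f assume f: "f \<in> bergman"
    show "S (A f) = f" by (rule eqI) (use S[OF maps[OF f]] f in blast)+
  next
    show "\<exists>C. \<forall>f\<in>bergman. L2_norm (S f) \<le> C * L2_norm f" using S by blast
  qed (use S in blast)+
qed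

lemma bergman_invertible_kernel:
  assumes "bergman_invertible A" "f \<in> bergman" "A f = (\<lambda>z. 0)"
  shows "f = (\<lambda>z. 0)"
proof -
  obtain S where S: "\<And>f g a b. f \<in> bergman \<Longrightarrow> g \<in> bergman \<Longrightarrow> S (\<lambda>z. a * f z + b * g z) = (\<lambda>z. a * S f z + b * S g z)"
      "\<And>f. f \<in> bergman \<Longrightarrow> S (A f) = f"
    using assms(1) unfolding bergman_invertible_def by blast
  have "S (\<lambda>z. 0) = (\<lambda>z. 0)" using S(1)[OF assms(2,2), of 0 0] by simp
  then show ?thesis using S(2)[OF assms(2)] assms(3) by simp
qed

section \<open>The shifted Toeplitz operator as a first order differential operator\<close>

definition disk_ext :: "(complex \<Rightarrow> complex) \<Rightarrow> complex \<Rightarrow> complex" where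
  "disk_ext f = (\<lambda>z. if z \<in> disk then f z else 0)"

lemma disk_ext_bergman: "f holomorphic_on disk \<Longrightarrow> sqint f \<Longrightarrow> disk_ext f \<in> bergman"
  using sqint_cong[of f "disk_ext f"] holomorphic_transform[of f disk "disk_ext f"]
  by (auto simp: bergman_iff disk_ext_def)

lemma L2_norm_disk_ext [simp]: "L2_norm (disk_ext f) = L2_norm f"
  by (rule L2_norm_cong) (simp add: disk_ext_def)

lemma disk_ext_bergman_id: "f \<in> bergman \<Longrightarrow> disk_ext f = f"
  by (auto simp: bergman_def disk_ext_def)

lemma open_disk [simp]: "open disk" and zero_in_disk [simp]: "0 \<in> disk"
  by (auto simp: disk_def)

lemma toeplitz_shift_eq:
  assumes g: "g holomorphic_on disk" and f: "f \<in> bergman" "\<And>z. z \<in> disk \<Longrightarrow> f z = g z + z * deriv g z"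
  shows "(\<lambda>z. toeplitz (\<lambda>z. cnj z + poly p z) f z - c * f z) =
    disk_ext (\<lambda>z. (1 + z * (poly p z - c)) * deriv g z + (poly p z - c) * g z)"
proof
  fix z
  have "toeplitz (\<lambda>z. cnj z + poly p z) f = (\<lambda>z. if z \<in> disk then deriv g z + poly p z * f z else 0)"
    by (rule toeplitz_conj_plus_poly[OF g f(1)]) (rule f(2))
  then show "toeplitz (\<lambda>z. cnj z + poly p z) f z - c * f z =
    disk_ext (\<lambda>z. (1 + z * (poly p z - c)) * deriv g z + (poly p z - c) * g z) z"
    using f by (auto simp: disk_ext_def algebra_simps bergman_def)
qed

lemma toeplitz_shift_bergman:
  assumes "f \<in> bergman"
  shows "(\<lambda>z. toeplitz (\<lambda>z. cnj z + poly p z) f z - c * f z) \<in> bergman"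
proof -
  obtain g where g: "g holomorphic_on disk" "\<And>z. z \<in> disk \<Longrightarrow> f z = g z + z * deriv g z"
    using holomorphic_disk_euler_antideriv assms by (auto simp: bergman_def)
  have "toeplitz (\<lambda>z. cnj z + poly p z) f \<in> bergman"
    using toeplitz_conj_plus_poly[OF g(1) assms g(2)] by simp
  from bergman_lincomb[OF this assms, of 1 "-c"] show ?thesis by simp
qed

text \<open>Linearity is read off from the differential operator, since \<open>f \<mapsto> g\<close>
  and differentiation respect linear combinations; \<open>bergman_proj\<close> itself is only a
  definite description.\<close>

lemma toeplitz_shift_linear:
  fixes p :: "complex poly" and a b c :: complex
  assumes f1: "f1 \<in> bergman" and f2: "f2 \<in> bergman"
  defines "A \<equiv> \<lambda>f z. toeplitz (\<lambda>z. cnj z + poly p z) f z - c * f z"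
  shows "A (\<lambda>z. a * f1 z + b * f2 z) = (\<lambda>z. a * A f1 z + b * A f2 z)"
proof -
  obtain g1 where g1: "g1 holomorphic_on disk" "\<And>z. z \<in> disk \<Longrightarrow> f1 z = g1 z + z * deriv g1 z"
    using holomorphic_disk_euler_antideriv f1 by (auto simp: bergman_def)
  obtain g2 where g2: "g2 holomorphic_on disk" "\<And>z. z \<in> disk \<Longrightarrow> f2 z = g2 z + z * deriv g2 z"
    using holomorphic_disk_euler_antideriv f2 by (auto simp: bergman_def)
  let ?g = "\<lambda>z. a * g1 z + b * g2 z"
  have d: "deriv ?g z = a * deriv g1 z + b * deriv g2 z" if "z \<in> disk" for z
    by (rule DERIV_imp_deriv)
      (use that g1 g2 in \<open>auto intro!: derivative_eq_intros holomorphic_derivI[of _ disk]\<close>)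
  have g: "?g holomorphic_on disk" by (intro holomorphic_intros g1 g2)
  have "A (\<lambda>z. a * f1 z + b * f2 z) = disk_ext (\<lambda>z. (1 + z * (poly p z - c)) * deriv ?g z + (poly p z - c) * ?g z)"
    unfolding A_def
    by (rule toeplitz_shift_eq[OF g bergman_lincomb[OF f1 f2]]) (simp add: d g1 g2 algebra_simps)
  moreover have "A f1 = disk_ext (\<lambda>z. (1 + z * (poly p z - c)) * deriv g1 z + (poly p z - c) * g1 z)"
    unfolding A_def by (rule toeplitz_shift_eq[OF g1(1) f1]) (rule g1(2))
  moreover have "A f2 = disk_ext (\<lambda>z. (1 + z * (poly p z - c)) * deriv g2 z + (poly p z - c) * g2 z)"
    unfolding A_def by (rule toeplitz_shift_eq[OF g2(1) f2]) (rule g2(2))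
  ultimately show ?thesis
    by (auto simp: disk_ext_def d algebra_simps fun_eq_iff)
qed

lemma sqint_bounded_holomorphic:
  assumes f: "f holomorphic_on disk" and M: "\<And>z. z \<in> disk \<Longrightarrow> cmod (f z) \<le> M"
  shows "sqint f"
proof -
  have "emeasure lborel disk < \<infinity>" unfolding disk_def by (rule emeasure_lborel_ball_finite)
  then have "sqint (\<lambda>z. 1)"
    by (auto simp: sqint_def set_integrable_def set_borel_measurable_def)
  from sqint_mult(1)[OF borel_measurable_disk_holomorphic[OF f] M this] show ?thesis by simp
qed

lemma continuous_cball_bounded_disk:
  assumes "continuous_on (cball 0 1) (F :: complex \<Rightarrow> complex)"
  shows "\<exists>M\<ge>0. \<forall>z\<in>disk. cmod (F z) \<le> M"
proof -
  have "bounded (F ` cball 0 1)"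
    by (intro compact_imp_bounded compact_continuous_image assms) auto
  then obtain M where "M > 0" "\<forall>x\<in>F ` cball 0 1. cmod x \<le> M" by (auto simp only: bounded_pos)
  then show ?thesis by (intro exI[of _ M]) (auto simp: disk_def)
qed

text \<open>The hypotheses say that the symbol minus \<open>c\<close> has no zero on the unit circle
  and winding number zero: \<open>1 + z * (poly p z - c)\<close> winds once, the factor
  \<open>z\<close> takes it back.\<close>

locale one_zero_symbol =
  fixes p R :: "complex poly" and a c :: complex
  assumes a: "cmod a < 1"
    and R: "\<And>z. cmod z \<le> 1 \<Longrightarrow> poly R z \<noteq> 0"
    and factor: "\<And>z. 1 + z * (poly p z - c) = (z - a) * poly R z"
begin

abbreviation "T \<equiv> (\<lambda>f z. toeplitz (\<lambda>z. cnj z + poly p z) f z - c * f z)"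

text \<open>The local exponent at \<open>a\<close>: the factorization gives
  \<open>poly p a - c = - 1 / a\<close>, so solutions of the homogeneous equation behave like
  \<open>(z - a)\<close> to the power \<open>1 / (a * poly R a)\<close>.\<close>

definition "\<mu> = 1 / (a * poly R a)"

lemma a_nonzero: "a \<noteq> 0"
  using factor[of 0] by auto

text \<open>Partial fractions: the quotient of \<open>p - c\<close> by \<open>(z - a) R\<close> is
  \<open>Q - \<mu> / (z - a)\<close> with \<open>Q\<close> regular on the closed disk.
  \<open>E\<close> is the exponential of minus a primitive of \<open>Q\<close>; it removes the
  regular part and leaves the pole alone.\<close>

lemma integrating_factor:
  obtains E Q M where "E holomorphic_on disk" "Q holomorphic_on disk" "0 \<le> M"
    "\<And>z. z \<in> disk \<Longrightarrow> (E has_field_derivative - Q z * E z) (at z)"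
    "\<And>z. z \<in> disk \<Longrightarrow> poly p z - c = poly R z * ((z - a) * Q z - \<mu>)"
    "\<And>z. E z \<noteq> 0"
    "\<And>z. z \<in> disk \<Longrightarrow> cmod (E z) \<le> M" "\<And>z. z \<in> disk \<Longrightarrow> cmod (Q z) \<le> M"
    "\<And>z. z \<in> disk \<Longrightarrow> cmod (1 / (E z * poly R z)) \<le> M"
proof -
  \<comment> \<open>\<open>\<mu>\<close> is exactly the multiple of \<open>R\<close> that cancels
    \<open>poly p a - c = - 1 / a\<close>.\<close>
  have "poly (p - [:c:] + smult \<mu> R) a = 0"
    using factor[of a] R[of a] a a_nonzero by (simp add: \<mu>_def field_simps)
  then obtain q where q: "p - [:c:] + smult \<mu> R = [:- a, 1:] * q"
    unfolding poly_eq_0_iff_dvd by (rule dvdE)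
  have qz: "poly p z - c + \<mu> * poly R z = (z - a) * poly q z" for z
    using arg_cong[OF q, of "\<lambda>r. poly r z"] by (simp add: algebra_simps)
  define Q where "Q = (\<lambda>z. poly q z / poly R z)"
  have Rd: "poly R z \<noteq> 0" if "z \<in> disk" for z using that R by (simp add: disk_def)
  have Q: "Q holomorphic_on disk" unfolding Q_def by (intro holomorphic_intros) (use Rd in auto)
  have "continuous_on (cball 0 1) Q" unfolding Q_def by (intro continuous_intros) (use R in auto)
  then obtain MQ where MQ: "\<And>z. z \<in> disk \<Longrightarrow> cmod (Q z) \<le> MQ" "0 \<le> MQ"
    using continuous_cball_bounded_disk[of Q] by blast
  have "continuous_on (cball 0 1) (\<lambda>z. 1 / poly R z)" by (intro continuous_intros) (use R in auto)
  then obtain MR where MR: "\<And>z. z \<in> disk \<Longrightarrow> cmod (1 / poly R z) \<le> MR" "0 \<le> MR"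
    using continuous_cball_bounded_disk[of "\<lambda>z. 1 / poly R z"] by blast
  obtain V where V: "\<And>z. z \<in> disk \<Longrightarrow> (V has_field_derivative Q z) (at z within disk)"
    using holomorphic_convex_primitive'[of disk Q] Q by (auto simp: disk_def)
  have V': "(V has_field_derivative Q z) (at z)" if "z \<in> disk" for z
    using V[OF that] that by (simp add: at_within_open[of _ disk])
  \<comment> \<open>A primitive of a bounded function is bounded on the disk; this bounds
    \<open>E\<close> and \<open>1 / E\<close> at once.\<close>
  have Vb: "cmod (V z - V 0) \<le> MQ" if "z \<in> disk" for z
  proof -
    have "cmod (V z - V 0) \<le> MQ * cmod (z - 0)"
      by (rule field_differentiable_bound[of disk V Q]) (use V MQ that in \<open>auto simp: disk_def\<close>)
    also have "\<dots> \<le> MQ * 1" using that MQ by (intro mult_left_mono) (auto simp: disk_def)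
    finally show ?thesis by simp
  qed
  define E where "E = (\<lambda>z. exp (V 0 - V z))"
  have E': "(E has_field_derivative - Q z * E z) (at z)" if "z \<in> disk" for z
    unfolding E_def by (rule derivative_eq_intros V'[OF that] refl | simp)+
  have E: "E holomorphic_on disk"
    using E' by (intro holomorphic_onI) (auto simp: field_differentiable_def intro: DERIV_subset)
  have Eb: "cmod (E z) \<le> exp MQ" "cmod (1 / E z) \<le> exp MQ" if "z \<in> disk" for z
  proof -
    have "cmod (E z) \<le> exp (cmod (V 0 - V z))" unfolding E_def by (rule norm_exp)
    also have "\<dots> \<le> exp MQ" using Vb[OF that] by (simp add: norm_minus_commute)
    finally show "cmod (E z) \<le> exp MQ" .
    have "1 / E z = exp (V z - V 0)" unfolding E_def by (simp add: exp_diff)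
    then have "cmod (1 / E z) \<le> exp (cmod (V z - V 0))" by (simp only: norm_exp)
    also have "\<dots> \<le> exp MQ" using Vb[OF that] by simp
    finally show "cmod (1 / E z) \<le> exp MQ" .
  qed
  define M where "M = exp MQ + MQ + exp MQ * MR"
  have MM: "exp MQ \<le> M" "MQ \<le> M" "exp MQ * MR \<le> M" "0 \<le> M"
    using MQ(2) MR(2) by (auto simp: M_def intro: add_nonneg_nonneg)
  show thesis
  proof (rule that[OF E Q MM(4) E'])
    show "poly p z - c = poly R z * ((z - a) * Q z - \<mu>)" if "z \<in> disk" for z
    proof -
      have "poly R z * ((z - a) * Q z - \<mu>) = (z - a) * poly q z - \<mu> * poly R z"
        using Rd[OF that] by (simp add: Q_def right_diff_distrib)
      moreover have "poly p z - c = (z - a) * poly q z - \<mu> * poly R z"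
        using qz[of z] by (simp add: eq_diff_eq)
      ultimately show ?thesis by (rule trans[OF _ sym, rotated])
    qed
    show "E z \<noteq> 0" for z by (simp add: E_def)
    show "cmod (E z) \<le> M" "cmod (Q z) \<le> M" if "z \<in> disk" for z
      using Eb(1)[OF that] MQ(1)[OF that] MM by auto
    show "cmod (1 / (E z * poly R z)) \<le> M" if "z \<in> disk" for z
    proof -
      have "cmod (1 / (E z * poly R z)) = cmod (1 / E z) * cmod (1 / poly R z)"
        by (simp add: norm_divide norm_mult)
      also have "\<dots> \<le> exp MQ * MR" by (intro mult_mono Eb MR that) auto
      finally show ?thesis using MM by simp
    qed
  qed
qed

text \<open>With \<open>g = E u\<close> one has \<open>(z g)' = E (1 - z Q) u + z E u'\<close>,
  whose coefficients are bounded; hence \<open>f\<close> is controlled by \<open>u\<close> and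
  \<open>u'\<close> together. The terms with \<open>Q\<close> cancel in \<open>T f\<close>.\<close>

lemma gauge_transform:
  obtains E K where "E holomorphic_on disk" "\<And>z. E z \<noteq> 0" "0 \<le> K"
    "\<And>z. z \<in> disk \<Longrightarrow> cmod (1 / (E z * poly R z)) \<le> K"
    "\<And>u. u holomorphic_on disk \<Longrightarrow> sqint u \<Longrightarrow> sqint (deriv u) \<Longrightarrow>
       disk_ext (\<lambda>z. E z * u z + z * deriv (\<lambda>z. E z * u z) z) \<in> bergman \<and>
       (L2_norm (disk_ext (\<lambda>z. E z * u z + z * deriv (\<lambda>z. E z * u z) z)))\<^sup>2 \<le> K * ((L2_norm u)\<^sup>2 + (L2_norm (deriv u))\<^sup>2)"
    "\<And>u f. u holomorphic_on disk \<Longrightarrow> f \<in> bergman \<Longrightarrow> (\<And>z. z \<in> disk \<Longrightarrow> f z = E z * u z + z * deriv (\<lambda>z. E z * u z) z) \<Longrightarrow>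
       T f = disk_ext (\<lambda>z. E z * poly R z * ((z - a) * deriv u z - \<mu> * u z))"
proof -
  obtain E Q M where E: "E holomorphic_on disk" and Q: "Q holomorphic_on disk" and M0: "0 \<le> M"
    and E': "\<And>z. z \<in> disk \<Longrightarrow> (E has_field_derivative - Q z * E z) (at z)"
    and q: "\<And>z. z \<in> disk \<Longrightarrow> poly p z - c = poly R z * ((z - a) * Q z - \<mu>)"
    and Enz: "\<And>z. E z \<noteq> 0"
    and Eb: "\<And>z. z \<in> disk \<Longrightarrow> cmod (E z) \<le> M" and Qb: "\<And>z. z \<in> disk \<Longrightarrow> cmod (Q z) \<le> M"
    and ERb: "\<And>z. z \<in> disk \<Longrightarrow> cmod (1 / (E z * poly R z)) \<le> M"
    by (rule integrating_factor) blast
  have dEu: "deriv (\<lambda>z. E z * u z) z = E z * deriv u z - Q z * E z * u z" if "u holomorphic_on disk" "z \<in> disk" for u z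
    by (rule DERIV_imp_deriv)
      (use that in \<open>auto intro!: derivative_eq_intros E' holomorphic_derivI[of _ disk]\<close>)
  define K where "K = M + 2 * (M * (1 + M))\<^sup>2 + 2 * M\<^sup>2"
  have K: "0 \<le> K" "M \<le> K" "2 * (M * (1 + M))\<^sup>2 \<le> K" "2 * M\<^sup>2 \<le> K" using M0 by (auto simp: K_def)
  show thesis
  proof (rule that[OF E Enz K(1)])
    show "cmod (1 / (E z * poly R z)) \<le> K" if "z \<in> disk" for z using ERb[OF that] K by simp
  next
    fix u assume u: "u holomorphic_on disk" "sqint u" "sqint (deriv u)"
    let ?f = "\<lambda>z. E z * u z + z * deriv (\<lambda>z. E z * u z) z"
    let ?f1 = "\<lambda>z. (E z * (1 - z * Q z)) * u z" and ?f2 = "\<lambda>z. (z * E z) * deriv u z"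
    have eq: "?f z = ?f1 z + ?f2 z" if "z \<in> disk" for z
      using that by (simp add: dEu[OF u(1)] algebra_simps)
    have b1: "cmod (E z * (1 - z * Q z)) \<le> M * (1 + M)" if "z \<in> disk" for z
    proof -
      have "cmod (z * Q z) \<le> 1 * M" unfolding norm_mult using that Qb by (intro mult_mono) (auto simp: disk_def)
      then have "cmod (1 - z * Q z) \<le> 1 + M" using norm_triangle_ineq4[of 1 "z * Q z"] by simp
      then show ?thesis unfolding norm_mult using Eb[OF that] M0 by (intro mult_mono) auto
    qed
    have b2: "cmod (z * E z) \<le> M" if "z \<in> disk" for z
      using mult_mono[of "cmod z" 1 "cmod (E z)" M] Eb[OF that] that by (auto simp: norm_mult disk_def)
    have h1: "(\<lambda>z. E z * (1 - z * Q z)) holomorphic_on disk" by (intro holomorphic_intros E Q)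
    have h2: "(\<lambda>z. z * E z) holomorphic_on disk" by (intro holomorphic_intros E)
    have s1: "sqint ?f1" "(L2_norm ?f1)\<^sup>2 \<le> (M * (1 + M))\<^sup>2 * (L2_norm u)\<^sup>2"
      using sqint_mult[OF borel_measurable_disk_holomorphic[OF h1] _ u(2), of "M * (1 + M)"] b1 by blast+
    have s2: "sqint ?f2" "(L2_norm ?f2)\<^sup>2 \<le> M\<^sup>2 * (L2_norm (deriv u))\<^sup>2"
      using sqint_mult[OF borel_measurable_disk_holomorphic[OF h2] _ u(3), of M] b2 by blast+
    note s = sqint_add[OF s1(1) s2(1)]
    have "sqint ?f" using s(1) sqint_cong[of ?f "\<lambda>z. ?f1 z + ?f2 z"] eq by blast
    moreover have "?f holomorphic_on disk"
      by (intro holomorphic_intros E u holomorphic_deriv) auto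
    ultimately have "disk_ext ?f \<in> bergman" by (intro disk_ext_bergman)
    moreover have "(L2_norm (disk_ext ?f))\<^sup>2 \<le> K * ((L2_norm u)\<^sup>2 + (L2_norm (deriv u))\<^sup>2)"
    proof -
      have e: "L2_norm (disk_ext ?f) = L2_norm (\<lambda>z. ?f1 z + ?f2 z)"
        using eq by (simp add: L2_norm_cong[of ?f "\<lambda>z. ?f1 z + ?f2 z"])
      have "(L2_norm (disk_ext ?f))\<^sup>2 \<le> 2 * ((M * (1 + M))\<^sup>2 * (L2_norm u)\<^sup>2) + 2 * (M\<^sup>2 * (L2_norm (deriv u))\<^sup>2)"
        unfolding e using s(2) s1(2) s2(2) by linarith
      also have "\<dots> = (2 * (M * (1 + M))\<^sup>2) * (L2_norm u)\<^sup>2 + (2 * M\<^sup>2) * (L2_norm (deriv u))\<^sup>2" by simp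
      also have "\<dots> \<le> K * (L2_norm u)\<^sup>2 + K * (L2_norm (deriv u))\<^sup>2"
        by (intro add_mono mult_right_mono K) auto
      finally show ?thesis by (simp add: distrib_left)
    qed
    ultimately show "disk_ext ?f \<in> bergman \<and> (L2_norm (disk_ext ?f))\<^sup>2 \<le> K * ((L2_norm u)\<^sup>2 + (L2_norm (deriv u))\<^sup>2)" ..
  next
    fix u f assume u: "u holomorphic_on disk" and f: "f \<in> bergman" "\<And>z. z \<in> disk \<Longrightarrow> f z = E z * u z + z * deriv (\<lambda>z. E z * u z) z"
    have "T f = disk_ext (\<lambda>z. (1 + z * (poly p z - c)) * deriv (\<lambda>z. E z * u z) z + (poly p z - c) * (E z * u z))"
      by (rule toeplitz_shift_eq[OF _ f]) (intro holomorphic_intros E u)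
    also have "\<dots> = disk_ext (\<lambda>z. E z * poly R z * ((z - a) * deriv u z - \<mu> * u z))"
    proof
      fix x
      show "disk_ext (\<lambda>z. (1 + z * (poly p z - c)) * deriv (\<lambda>z. E z * u z) z + (poly p z - c) * (E z * u z)) x =
          disk_ext (\<lambda>z. E z * poly R z * ((z - a) * deriv u z - \<mu> * u z)) x"
      proof (cases "x \<in> disk")
        case True
        then show ?thesis
          by (simp only: disk_ext_def if_True factor dEu[OF u True] q[OF True]) (simp add: algebra_simps)
      qed (simp add: disk_ext_def)
    qed
    finally show "T f = disk_ext (\<lambda>z. E z * poly R z * ((z - a) * deriv u z - \<mu> * u z))" .
  qed
qed

proposition invertible:
  assumes \<mu>: "\<And>n. \<mu> \<noteq> of_nat n"
  shows "bergman_invertible T"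
proof -
  obtain E K where E: "E holomorphic_on disk" and Enz: "\<And>z. E z \<noteq> 0" and K: "0 \<le> K"
    and ERb: "\<And>z. z \<in> disk \<Longrightarrow> cmod (1 / (E z * poly R z)) \<le> K"
    and berg: "\<And>u. u holomorphic_on disk \<Longrightarrow> sqint u \<Longrightarrow> sqint (deriv u) \<Longrightarrow>
       disk_ext (\<lambda>z. E z * u z + z * deriv (\<lambda>z. E z * u z) z) \<in> bergman \<and>
       (L2_norm (disk_ext (\<lambda>z. E z * u z + z * deriv (\<lambda>z. E z * u z) z)))\<^sup>2 \<le> K * ((L2_norm u)\<^sup>2 + (L2_norm (deriv u))\<^sup>2)"
    and T: "\<And>u f. u holomorphic_on disk \<Longrightarrow> f \<in> bergman \<Longrightarrow> (\<And>z. z \<in> disk \<Longrightarrow> f z = E z * u z + z * deriv (\<lambda>z. E z * u z) z) \<Longrightarrow>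
       T f = disk_ext (\<lambda>z. E z * poly R z * ((z - a) * deriv u z - \<mu> * u z))"
    by (rule gauge_transform) blast
  obtain C where C: "C \<ge> 0" and sol: "\<And>h. h holomorphic_on disk \<Longrightarrow> sqint h \<Longrightarrow>
      \<exists>u. u holomorphic_on disk \<and> (\<forall>z\<in>disk. (z - a) * deriv u z - \<mu> * u z = h z) \<and>
        sqint u \<and> sqint (deriv u) \<and>
        (L2_norm u)\<^sup>2 \<le> C * (L2_norm h)\<^sup>2 \<and> (L2_norm (deriv u))\<^sup>2 \<le> C * (L2_norm h)\<^sup>2"
    by (rule fuchs_equation_solution[OF a \<mu>]) blast
  have Rd: "poly R z \<noteq> 0" if "z \<in> disk" for z using that R by (simp add: disk_def)
  have ad: "a \<in> disk" using a by (simp add: disk_def)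
  show ?thesis
  \<comment> \<open>The factors come from bounding \<open>f\<close> by \<open>u\<close> and
    \<open>u'\<close>, from bounding each of these two by the reduced right-hand side, and from
    dividing that side by \<open>E R\<close>.\<close>
  proof (rule bergman_invertibleI[where C="sqrt (K * (2 * C) * K\<^sup>2)"])
    fix f assume f: "f \<in> bergman" and T0: "T f = (\<lambda>z. 0)"
    obtain g where g: "g holomorphic_on disk" "\<And>z. z \<in> disk \<Longrightarrow> f z = g z + z * deriv g z"
      using holomorphic_disk_euler_antideriv f by (auto simp: bergman_def)
    let ?u = "\<lambda>z. g z / E z"
    have u: "?u holomorphic_on disk" by (intro holomorphic_intros g E) (use Enz in auto)
    have "T f = disk_ext (\<lambda>z. E z * poly R z * ((z - a) * deriv ?u z - \<mu> * ?u z))"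
      by (rule T[OF u f]) (use g Enz in simp)
    with T0 have "disk_ext (\<lambda>z. E z * poly R z * ((z - a) * deriv ?u z - \<mu> * ?u z)) = (\<lambda>z. 0)" by (rule trans[OF sym, rotated])
    then have "disk_ext (\<lambda>z. E z * poly R z * ((z - a) * deriv ?u z - \<mu> * ?u z)) z = 0" for z
      by (rule fun_cong)
    note Tz = this
    have "(z - a) * deriv ?u z - \<mu> * ?u z = 0" if z: "z \<in> disk" for z
    proof -
      have "E z * poly R z * ((z - a) * deriv ?u z - \<mu> * ?u z) = 0"
        using Tz[of z] by (simp only: disk_ext_def z if_True)
      moreover have "E z * poly R z \<noteq> 0" using Enz Rd[OF z] by simp
      ultimately show ?thesis by (metis mult_eq_0_iff)
    qed
    then have "g z / E z = 0" if "z \<in> disk" for z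
      using that by (rule fuchs_equation_unique[OF ad \<mu> u])
    then have g0: "g z = 0" if "z \<in> disk" for z using that Enz[of z] divide_eq_0_iff by blast
    have "deriv g z = 0" if "z \<in> disk" for z
      using that complex_derivative_transform_within_open[OF g(1) holomorphic_on_const open_disk that, of 0] g0 by simp
    then have "f z = 0" if "z \<in> disk" for z using g(2)[OF that] g0[OF that] that by simp
    then show "f = (\<lambda>z. 0)" using f by (auto simp: bergman_def)
  next
    fix h assume h: "h \<in> bergman"
    let ?k = "\<lambda>z. 1 / (E z * poly R z)"
    let ?h = "\<lambda>z. ?k z * h z"
    have k: "?k holomorphic_on disk" by (intro holomorphic_intros E) (use Enz Rd in auto)
    have hh: "h holomorphic_on disk" "sqint h" using h by (auto simp: bergman_iff)
    have h1: "sqint ?h" "(L2_norm ?h)\<^sup>2 \<le> K\<^sup>2 * (L2_norm h)\<^sup>2"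
      using sqint_mult[OF borel_measurable_disk_holomorphic[OF k] _ hh(2), of K] ERb by blast+
    have "?h holomorphic_on disk" by (intro holomorphic_on_mult k hh)
    from sol[OF this h1(1)] obtain u where u: "u holomorphic_on disk" "sqint u" "sqint (deriv u)"
      and eq: "\<forall>z\<in>disk. (z - a) * deriv u z - \<mu> * u z = ?h z"
      and ub: "(L2_norm u)\<^sup>2 \<le> C * (L2_norm ?h)\<^sup>2" "(L2_norm (deriv u))\<^sup>2 \<le> C * (L2_norm ?h)\<^sup>2" by blast
    let ?f = "disk_ext (\<lambda>z. E z * u z + z * deriv (\<lambda>z. E z * u z) z)"
    have f: "?f \<in> bergman" "(L2_norm ?f)\<^sup>2 \<le> K * ((L2_norm u)\<^sup>2 + (L2_norm (deriv u))\<^sup>2)"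
      using berg[OF u] by blast+
    have "T ?f = disk_ext (\<lambda>z. E z * poly R z * ((z - a) * deriv u z - \<mu> * u z))"
      by (rule T[OF u(1) f(1)]) (simp add: disk_ext_def)
    also have "\<dots> = disk_ext h"
      using eq Enz Rd by (auto simp: disk_ext_def fun_eq_iff)
    also have "\<dots> = h" by (rule disk_ext_bergman_id[OF h])
    finally have Tf: "T ?f = h" .
    have "(L2_norm ?f)\<^sup>2 \<le> K * ((L2_norm u)\<^sup>2 + (L2_norm (deriv u))\<^sup>2)" by (rule f)
    also have "\<dots> \<le> K * (2 * C * (L2_norm ?h)\<^sup>2)"
      using ub K by (intro mult_left_mono) auto
    also have "\<dots> \<le> K * (2 * C * (K\<^sup>2 * (L2_norm h)\<^sup>2))"
      using h1(2) K C by (intro mult_left_mono) auto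
    finally have "(L2_norm ?f)\<^sup>2 \<le> (K * (2 * C) * K\<^sup>2) * (L2_norm h)\<^sup>2" by (simp only: mult_ac)
    then have "sqrt ((L2_norm ?f)\<^sup>2) \<le> sqrt ((K * (2 * C) * K\<^sup>2) * (L2_norm h)\<^sup>2)"
      by (rule real_sqrt_le_mono)
    then have "L2_norm ?f \<le> sqrt (K * (2 * C) * K\<^sup>2) * L2_norm h"
      by (simp only: real_sqrt_mult real_sqrt_abs abs_of_nonneg L2_norm_nonneg)
    with f Tf show "\<exists>f\<in>bergman. T f = h \<and> L2_norm f \<le> sqrt (K * (2 * C) * K\<^sup>2) * L2_norm h" by blast
  qed (auto intro: toeplitz_shift_bergman toeplitz_shift_linear)
qed

proposition not_invertible:
  assumes \<mu>: "\<mu> = of_nat m"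
  shows "\<not> bergman_invertible T"
proof
  assume inv: "bergman_invertible T"
  obtain E K where E: "E holomorphic_on disk" and Enz: "\<And>z. E z \<noteq> 0"
    and berg: "\<And>u. u holomorphic_on disk \<Longrightarrow> sqint u \<Longrightarrow> sqint (deriv u) \<Longrightarrow>
       disk_ext (\<lambda>z. E z * u z + z * deriv (\<lambda>z. E z * u z) z) \<in> bergman \<and>
       (L2_norm (disk_ext (\<lambda>z. E z * u z + z * deriv (\<lambda>z. E z * u z) z)))\<^sup>2 \<le> K * ((L2_norm u)\<^sup>2 + (L2_norm (deriv u))\<^sup>2)"
    and T: "\<And>u f. u holomorphic_on disk \<Longrightarrow> f \<in> bergman \<Longrightarrow> (\<And>z. z \<in> disk \<Longrightarrow> f z = E z * u z + z * deriv (\<lambda>z. E z * u z) z) \<Longrightarrow>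
       T f = disk_ext (\<lambda>z. E z * poly R z * ((z - a) * deriv u z - \<mu> * u z))"
    by (rule gauge_transform) blast
  let ?r = "[:- a, 1:] ^ m"
  let ?u = "poly ?r"
  have du: "deriv ?u = poly (pderiv ?r)" by (rule ext, rule DERIV_imp_deriv, rule poly_DERIV)
  have bd: "sqint (poly r)" for r
  proof -
    obtain M where "\<forall>z\<in>disk. cmod (poly r z) \<le> M" using poly_bounded_disk[of r] by blast
    then show ?thesis by (intro sqint_bounded_holomorphic[of _ M] holomorphic_intros) auto
  qed
  have u: "?u holomorphic_on disk" "sqint ?u" "sqint (deriv ?u)"
    unfolding du by (rule bd holomorphic_intros)+
  have eq: "(z - a) * deriv ?u z - \<mu> * ?u z = 0" for z
  proof (cases m)
    case (Suc n)
    have "poly (pderiv ?r) z = of_nat m * (z - a) ^ n"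
      unfolding Suc pderiv_power_Suc by (simp add: pderiv_pCons)
    moreover have "?u z = (z - a) * (z - a) ^ n" by (simp add: Suc algebra_simps)
    ultimately show ?thesis unfolding du \<mu> by simp
  next
    case 0
    then show ?thesis unfolding du \<mu> by simp
  qed
  let ?f = "disk_ext (\<lambda>z. E z * ?u z + z * deriv (\<lambda>z. E z * ?u z) z)"
  have f: "?f \<in> bergman" using berg[OF u] by blast
  have "T ?f = disk_ext (\<lambda>z. E z * poly R z * ((z - a) * deriv ?u z - \<mu> * ?u z))"
    by (rule T[OF u(1) f]) (simp add: disk_ext_def)
  also have "\<dots> = (\<lambda>z. 0)" unfolding eq by (simp add: disk_ext_def)
  finally have "?f = (\<lambda>z. 0)" by (rule bergman_invertible_kernel[OF inv f])
  \<comment> \<open>At 0 only \<open>E 0 * (- a) ^ m\<close> survives, which is nonzero; so the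
    kernel function is not trivial.\<close>
  then have "?f 0 = 0" by (rule fun_cong)
  then show False using Enz[of 0] a_nonzero by (simp add: disk_ext_def)
qed

end

section \<open>Values of the symbol on the unit circle\<close>

lemma pser_geometric:
  assumes "cmod b \<le> 1"
  shows "pser (\<lambda>n. b ^ n) (\<lambda>z. 1 / (1 - b * z))"
proof (unfold pser_def, intro ballI)
  fix z assume "z \<in> disk"
  then have "cmod (b * z) < 1"
    using assms mult_right_mono[of "cmod b" 1 "cmod z"] by (auto simp: disk_def norm_mult)
  from geometric_sums[OF this] show "(\<lambda>n. b ^ n * z ^ n) sums (1 / (1 - b * z))"
    by (simp add: power_mult_distrib)
qed

text \<open>At such a value \<open>1 + z (p - c)\<close> vanishes at the boundary point
  \<open>w\<close>. For functions peaking at \<open>w\<close> this zero cancels one order of growth,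
  so the operator maps functions of large norm to much smaller ones, and no inverse is
  bounded.\<close>

proposition circle_point_not_invertible:
  assumes w: "cmod w = 1"
  shows "\<not> bergman_invertible (\<lambda>f z. toeplitz (\<lambda>z. cnj z + poly p z) f z - (cnj w + poly p w) * f z)"
    (is "\<not> bergman_invertible ?A")
proof
  assume "bergman_invertible ?A"
  then obtain S C where S: "\<And>f. f \<in> bergman \<Longrightarrow> S (?A f) = f"
    and C: "\<And>f. f \<in> bergman \<Longrightarrow> L2_norm (S f) \<le> C * L2_norm f"
    unfolding bergman_invertible_def by blast
  define c where "c = cnj w + poly p w"
  have wc: "w * cnj w = 1" using w by (simp add: complex_norm_square[symmetric])
  have "poly ([:1:] + [:0,1:] * (p - [:c:])) w = 0"
    using wc by (simp add: c_def algebra_simps)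
  then obtain R where "[:1:] + [:0,1:] * (p - [:c:]) = [:- w, 1:] * R"
    unfolding poly_eq_0_iff_dvd by (rule dvdE)
  from arg_cong[OF this, of "\<lambda>r. poly r z" for z]
  have "poly ([:1:] + [:0,1:] * (p - [:c:])) z = poly ([:- w, 1:] * R) z" for z .
  then have R: "1 + z * (poly p z - c) = (z - w) * poly R z" for z
    unfolding poly_add poly_mult poly_diff by (simp add: add.commute)
  obtain M1 where M1: "\<forall>z\<in>disk. cmod (poly R z) \<le> M1" using poly_bounded_disk by blast
  obtain M2 where M2: "\<forall>z\<in>disk. cmod (poly (p - [:c:]) z) \<le> M2" using poly_bounded_disk by blast
  define M where "M = 2 * M1 + M2"
  have M0: "0 \<le> M1" "0 \<le> M2" using M1 M2 zero_in_disk norm_ge_zero order.trans by blast+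
  have key: "1 \<le> (C * M)\<^sup>2 * (1 - t\<^sup>2)" if t: "0 < t" "t < 1" for t :: real
  proof -
    \<comment> \<open>With \<open>g = 1 / (1 - b z)\<close> the test function
      \<open>(z g)' = 1 / (1 - b z)^2\<close> is the Bergman kernel at \<open>t w\<close>; its
      squared norm is \<open>1 / (1 - t^2)^2\<close>, while that of \<open>g\<close> is at most
      \<open>1 / (1 - t^2)\<close>.\<close>
    define b where "b = of_real t * cnj w"
    have b: "cmod b = t" "cmod b < 1" using w t by (auto simp: b_def norm_mult)
    let ?g = "\<lambda>z. 1 / (1 - b * z)"
    have g: "pser (\<lambda>n. b ^ n) ?g" using b by (intro pser_geometric) simp
    have nz: "1 - b * z \<noteq> 0" if "z \<in> disk" for z
    proof
      assume "1 - b * z = 0"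
      then have "cmod (b * z) = 1" by simp
      moreover have "cmod (b * z) \<le> cmod b * 1" unfolding norm_mult using that by (intro mult_left_mono) (auto simp: disk_def)
      ultimately show False using b by simp
    qed
    have dg: "deriv ?g z = b / (1 - b * z)\<^sup>2" if "z \<in> disk" for z
      by (rule DERIV_imp_deriv) (use nz[OF that] in \<open>auto intro!: derivative_eq_intros simp: power2_eq_square\<close>)
    have t2: "t * t < 1" using mult_strict_mono[of t 1 t 1] t by simp
    have sm1: "(\<lambda>n. (cmod (b ^ n))\<^sup>2) sums (1 / (1 - t\<^sup>2))"
      using geometric_sums[of "t\<^sup>2"] t t2 by (simp add: norm_power b power2_eq_square power_mult_distrib abs_square_less_1)
    have sm2: "(\<lambda>n. of_nat (Suc n) * (cmod (b ^ n))\<^sup>2) sums (1 / (1 - t\<^sup>2)\<^sup>2)"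
      using geometric_deriv_sums[of "t\<^sup>2"] t t2 by (simp add: norm_power b power2_eq_square power_mult_distrib abs_square_less_1)
    let ?f = "\<lambda>z. ?g z + z * deriv ?g z"
    have f: "pser (\<lambda>n. of_nat (Suc n) * b ^ n) ?f" by (rule pser_euler[OF g])
    have fterm: "(cmod (of_nat (Suc n) * b ^ n))\<^sup>2 / (real n + 1) = of_nat (Suc n) * (cmod (b ^ n))\<^sup>2" for n
      unfolding norm_mult norm_of_nat power_mult_distrib by (simp add: power2_eq_square field_simps)
    have smf: "summable (\<lambda>n. (cmod (of_nat (Suc n) * b ^ n))\<^sup>2 / (real n + 1))"
      unfolding fterm using sm2 by (rule sums_summable)
    have fn: "(L2_norm ?f)\<^sup>2 = 1 / (1 - t\<^sup>2)\<^sup>2"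
      using sums_unique2[OF pser_L2_norm_sums[OF f smf, unfolded fterm] sm2] .
    have gle: "norm ((cmod (b ^ n))\<^sup>2 / (real n + 1)) \<le> (cmod (b ^ n))\<^sup>2" for n
      using divide_left_mono[of 1 "real n + 1" "(cmod (b ^ n))\<^sup>2"] by simp
    have smg: "summable (\<lambda>n. (cmod (b ^ n))\<^sup>2 / (real n + 1))"
      by (rule summable_comparison_test'[OF sums_summable[OF sm1]]) (rule gle)
    have gn: "(L2_norm ?g)\<^sup>2 \<le> 1 / (1 - t\<^sup>2)"
    proof -
      have "(L2_norm ?g)\<^sup>2 = (\<Sum>n. (cmod (b ^ n))\<^sup>2 / (real n + 1))"
        using pser_L2_norm_sums[OF g smg] by (simp add: sums_iff)
      also have "\<dots> \<le> (\<Sum>n. (cmod (b ^ n))\<^sup>2)"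
        using gle by (intro suminf_le smg sums_summable[OF sm1]) (auto dest: order.trans[OF abs_ge_self])
      also have "\<dots> = 1 / (1 - t\<^sup>2)" using sm1 by (simp add: sums_iff)
      finally show ?thesis .
    qed
    have fb: "disk_ext ?f \<in> bergman"
      by (rule disk_ext_bergman[OF pser_holomorphic[OF f] pser_sqint[OF f smf]])
    have Af: "?A (disk_ext ?f) = disk_ext (\<lambda>z. (1 + z * (poly p z - c)) * deriv ?g z + (poly p z - c) * ?g z)"
      unfolding c_def by (rule toeplitz_shift_eq[OF pser_holomorphic[OF g] fb]) (simp add: disk_ext_def)
    \<comment> \<open>The image of the test function is \<open>?k * ?g\<close>; what is needed is a
      bound for \<open>?k\<close> independent of \<open>t\<close>, that is, \<open>|z - w|\<close>
      against \<open>|1 - b z|\<close>.\<close>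
    let ?k = "\<lambda>z. poly R z * ((z - w) * b / (1 - b * z)) + (poly p z - c)"
    have eq: "(1 + z * (poly p z - c)) * deriv ?g z + (poly p z - c) * ?g z = ?k z * ?g z" if "z \<in> disk" for z
    proof -
      have "x * y * (b / d\<^sup>2) + q * (1 / d) = (y * (x * b / d) + q) * (1 / d)" for x y q d :: complex
        by (simp add: power2_eq_square add_divide_distrib mult_ac)
      then show ?thesis unfolding R dg[OF that] .
    qed
    have kb: "cmod (?k z) \<le> M" if z: "z \<in> disk" for z
    proof -
      have z1: "cmod z \<le> 1" using z by (simp add: disk_def)
      have "cmod ((z - w) * b) = t * cmod (1 - cnj w * z)"
      proof -
        have "w * (cnj w * z - 1) = (w * cnj w) * z - w" by (simp only: right_diff_distrib mult.assoc mult_1_right)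
        then have "z - w = w * (cnj w * z - 1)" using wc by simp
        then show ?thesis using w b by (simp add: norm_mult norm_minus_commute)
      qed
      also have "\<dots> \<le> 1 * cmod (1 - cnj w * z)" using t by (intro mult_right_mono) auto
      also have "\<dots> \<le> 2 * cmod (1 - b * z)"
      proof -
        \<comment> \<open>The correction has modulus at most \<open>1 - t\<close>, and
          \<open>1 - t \<le> |1 - b z|\<close>; hence the constant 2.\<close>
        have "1 - cnj w * z = (1 - b * z) - of_real (1 - t) * (cnj w * z)"
          by (simp add: b_def algebra_simps)
        then have "cmod (1 - cnj w * z) \<le> cmod (1 - b * z) + cmod (of_real (1 - t) * (cnj w * z))"
          by (metis norm_triangle_ineq4)
        also have "cmod (of_real (1 - t) * (cnj w * z)) \<le> 1 - t"
        proof -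
          have "cmod (of_real (1 - t) * (cnj w * z)) = (1 - t) * cmod z"
            using t w by (simp only: norm_mult norm_of_real complex_mod_cnj)
          also have "\<dots> \<le> (1 - t) * 1" using t z1 by (intro mult_left_mono) auto
          finally show ?thesis by simp
        qed
        also have "1 - t \<le> cmod (1 - b * z)"
        proof -
          have "cmod (b * z) \<le> t" unfolding norm_mult b using t z1 mult_left_mono[of "cmod z" 1 t] by simp
          then show ?thesis using norm_triangle_ineq2[of 1 "b * z"] by simp
        qed
        finally show ?thesis by simp
      qed
      finally have "cmod ((z - w) * b / (1 - b * z)) \<le> 2"
        using nz[OF z] by (simp add: norm_divide divide_le_eq)
      then have "cmod (poly R z * ((z - w) * b / (1 - b * z))) \<le> M1 * 2"
        unfolding norm_mult[of "poly R z"] using M1 z M0 by (intro mult_mono) auto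
      moreover have "cmod (poly p z - c) \<le> M2" using M2 z by auto
      ultimately show ?thesis unfolding M_def by (intro order.trans[OF norm_triangle_ineq]) simp
    qed
    have kh: "?k holomorphic_on disk" by (intro holomorphic_intros) (use nz in auto)
    have "(L2_norm (\<lambda>z. ?k z * ?g z))\<^sup>2 \<le> M\<^sup>2 * (L2_norm ?g)\<^sup>2"
      using sqint_mult(2)[OF borel_measurable_disk_holomorphic[OF kh] _ pser_sqint[OF g smg], of M] kb by blast
    also have "L2_norm (\<lambda>z. ?k z * ?g z) = L2_norm (?A (disk_ext ?f))"
      unfolding Af L2_norm_disk_ext by (rule L2_norm_cong[symmetric]) (rule eq)
    finally have Ab: "(L2_norm (?A (disk_ext ?f)))\<^sup>2 \<le> M\<^sup>2 * (1 / (1 - t\<^sup>2))"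
      using gn by (meson mult_left_mono order.trans zero_le_power2)
    have AB: "?A (disk_ext ?f) \<in> bergman" by (rule toeplitz_shift_bergman[OF fb])
    have "L2_norm (disk_ext ?f) \<le> C * L2_norm (?A (disk_ext ?f))"
      using C[OF AB] unfolding S[OF fb] .
    then have "(L2_norm (disk_ext ?f))\<^sup>2 \<le> (C * L2_norm (?A (disk_ext ?f)))\<^sup>2"
      by (rule power_mono) (rule L2_norm_nonneg)
    also have "\<dots> = C\<^sup>2 * (L2_norm (?A (disk_ext ?f)))\<^sup>2" by (rule power_mult_distrib)
    also have "\<dots> \<le> C\<^sup>2 * (M\<^sup>2 * (1 / (1 - t\<^sup>2)))" by (rule mult_left_mono[OF Ab]) simp
    finally have fin: "1 / (1 - t\<^sup>2)\<^sup>2 \<le> (C * M)\<^sup>2 / (1 - t\<^sup>2)"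
      unfolding L2_norm_disk_ext fn by (simp add: power_mult_distrib)
    have "0 < 1 - t\<^sup>2" using t by (simp add: abs_square_less_1)
    then show ?thesis using fin by (simp add: divide_simps power2_eq_square)
  qed
  \<comment> \<open>Letting \<open>t\<close> tend to 1 in \<open>key\<close>, whose constant does
    not depend on \<open>t\<close>, gives the contradiction \<open>1 \<le> 0\<close>.\<close>
  have "((\<lambda>t. (C * M)\<^sup>2 * (1 - t\<^sup>2)) \<longlongrightarrow> (C * M)\<^sup>2 * (1 - 1\<^sup>2)) (at_left (1::real))"
    by (intro tendsto_intros)
  moreover have "eventually (\<lambda>t. 1 \<le> (C * M)\<^sup>2 * (1 - t\<^sup>2)) (at_left (1::real))"
    by (rule eventually_mono[OF eventually_at_left_real[of 0 1]]) (use key in auto)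
  ultimately have "1 \<le> (C * M)\<^sup>2 * (1 - 1\<^sup>2)"
    by (intro tendsto_lowerbound) auto
  then show False by simp
qed

section \<open>The polynomial\<close>

lemma poly_pderiv_linear_factor:
  "poly (pderiv ([:- b, 1:] * R)) b = poly R (b :: complex)"
  by (simp only: pderiv_mult poly_add poly_mult) (simp add: pderiv_pCons)

lemma one_zero_poly_exists:
  assumes k: "k > 2"
  obtains p R :: "complex poly" and a :: complex where
    "degree p = k" "0 < cmod a" "cmod a < 1"
    "\<And>z. cmod z \<le> 1 \<Longrightarrow> poly R z \<noteq> 0"
    "pCons 1 p = [:- a, 1:] * R"
    "a * poly R a = 1 / 2"
proof -
  define c where "c = root k (1 / 2)"
  have c: "0 < c" "c < 1" "c ^ k = 1 / 2" using k by (auto simp: c_def)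
  \<comment> \<open>A \<open>k\<close>-th root of \<open>- 1 / 2\<close> with argument
    \<open>pi / k\<close>, the direction closest to the positive axis, which keeps \<open>s\<close>
    small.\<close>
  define s where "s = 1 - of_real c * cis (pi / real k)"
  have sk: "(1 - s) ^ k = - 1 / 2"
  proof -
    have "cis (pi / real k) ^ k = - 1" using k by (simp add: Complex.DeMoivre)
    moreover have "complex_of_real c ^ k = 1 / 2" using c(3) by (metis of_real_1 of_real_divide of_real_numeral of_real_power)
    ultimately show ?thesis by (simp add: s_def power_mult_distrib)
  qed
  have s0: "s \<noteq> 0"
  proof
    assume "s = 0"
    then have "Re ((1::complex) ^ k) = Re (- 1 / 2)" using sk by simp
    then show False by simp
  qed
  have s1: "cmod s < 1"
  proof -
    \<comment> \<open>Here \<open>k > 2\<close> enters: the cosine is at least \<open>1 / 2\<close>,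
      so \<open>|s|^2 \<le> 1 - c + c^2 < 1\<close>.\<close>
    have "pi / real k \<le> pi / 3" using k by (intro divide_left_mono) auto
    then have "cos (pi / 3) \<le> cos (pi / real k)" by (intro cos_monotone_0_pi_le) auto
    then have cs: "1 / 2 \<le> cos (pi / real k)" by (simp add: cos_60)
    have expand: "(1 - c * x)\<^sup>2 + (c * y)\<^sup>2 = 1 - 2 * c * x + c\<^sup>2 * (x\<^sup>2 + y\<^sup>2)" for x y
      by (simp add: power2_eq_square algebra_simps)
    have "(cmod s)\<^sup>2 = (1 - c * cos (pi / real k))\<^sup>2 + (c * sin (pi / real k))\<^sup>2"
      by (simp add: s_def cmod_power2)
    also have "\<dots> = 1 - 2 * c * cos (pi / real k) + c * c"
      unfolding expand by (simp add: power2_eq_square)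
    also have "\<dots> < 1"
    proof -
      have "c * c < c * 1" using c by (intro mult_strict_left_mono) auto
      moreover have "c * (1 / 2) \<le> c * cos (pi / real k)" using c cs by (intro mult_left_mono) auto
      ultimately show ?thesis by linarith
    qed
    finally show ?thesis by (simp add: abs_square_less_1)
  qed
  \<comment> \<open>Any modulus strictly between \<open>|s|\<close> and 1 would do: below 1 puts the
    zero \<open>a\<close> inside, above \<open>|s|\<close> puts the zero \<open>a / s\<close>
    outside the closed disk.\<close>
  define a where "a = complex_of_real ((1 + cmod s) / 2)"
  have na: "cmod a = (1 + cmod s) / 2" unfolding a_def norm_of_real using norm_ge_zero[of s] by simp
  have a: "0 < cmod a" "cmod a < 1" "cmod s < cmod a" using s1 norm_ge_zero[of s] by (auto simp: na intro: add_pos_nonneg)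
  then have a0: "a \<noteq> 0" by auto
  \<comment> \<open>The scalar makes \<open>(z - a) R\<close> equal to 1 at 0, so that it has the
    form \<open>1 + z p\<close>; the degree \<open>k\<close> needs
    \<open>s \<noteq> 0\<close>.\<close>
  define R where "R = smult (- 1 / a) ([:1, - s / a:] ^ k)"
  have Rz: "poly R z = (- 1 / a) * (1 - z * s / a) ^ k" for z by (simp add: R_def)
  have Rnz: "poly R z \<noteq> 0" if "cmod z \<le> 1" for z
  proof
    assume "poly R z = 0"
    then have "z * s = a" using a0 by (simp add: Rz)
    then have "cmod a = cmod z * cmod s" by (metis norm_mult)
    also have "\<dots> \<le> 1 * cmod s" using that by (intro mult_right_mono) auto
    finally show False using a by simp
  qed
  define r where "r = [:- a, 1:] * R"
  have "degree ([:1, - s / a:] ^ k) = k" using s0 a0 by (simp add: degree_power_eq)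
  then have dR: "degree R = k" using a0 by (simp add: R_def)
  then have R0: "R \<noteq> 0" using k by auto
  have dr: "degree r = Suc k" unfolding r_def using R0 dR by (subst degree_mult_eq) auto
  obtain x p where rp: "r = pCons x p" by (rule pCons_cases)
  have "x = poly r 0" by (simp add: rp)
  also have "\<dots> = 1" using a0 by (simp add: r_def Rz)
  finally have rp: "pCons 1 p = [:- a, 1:] * R" using rp by (simp add: r_def)
  have "degree p = k"
  proof -
    have "degree (pCons 1 p) = Suc k" using dr rp by (simp add: r_def)
    then show ?thesis by (cases "p = 0") auto
  qed
  moreover have "a * poly R a = 1 / 2" using a0 sk by (simp add: Rz)
  ultimately show thesis using that a Rnz rp by blast
qed

text \<open>\<open>r - c z\<close> vanishes at a nonzero \<open>z\<close> iff
  \<open>\<phi> z = r / z\<close> equals \<open>c\<close>, so the moved root is a local inverse of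
  \<open>\<phi>\<close> at \<open>c\<close>. Its exponent is \<open>1 / \<psi>\<close> evaluated
  there: near 2 by continuity, and different from 2 because \<open>\<psi>\<close> takes the value
  \<open>1 / 2\<close> only at isolated points.\<close>

lemma zero_perturbation:
  fixes p R :: "complex poly" and a :: complex
  assumes a: "0 < cmod a" "cmod a < 1" and Rnz: "\<And>z. cmod z \<le> 1 \<Longrightarrow> poly R z \<noteq> 0"
    and rp: "pCons 1 p = [:- a, 1:] * R" and half: "a * poly R a = 1 / 2"
  obtains e where "e > 0"
    "\<And>c. c \<noteq> 0 \<Longrightarrow> cmod c < e \<Longrightarrow>
       \<exists>b R'. one_zero_symbol p R' b c \<and> (\<forall>n. one_zero_symbol.\<mu> R' b \<noteq> of_nat n)"
proof -
  define r where "r = pCons 1 p"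
  have rz: "poly r z = 1 + z * poly p z" for z by (simp add: r_def)
  have rR: "poly r z = (z - a) * poly R z" for z unfolding r_def rp by (simp add: algebra_simps)
  \<comment> \<open>Both \<open>z^2 \<phi>'\<close> and, at the moved root \<open>b\<close>, the
    quantity \<open>b R'(b) = b (r'(b) - c)\<close>, since \<open>c b = r(b)\<close>.\<close>
  define \<psi> where "\<psi> = [:0, 1:] * pderiv r - r"
  have \<psi>z: "poly \<psi> z = z * poly (pderiv r) z - poly r z" for z by (simp add: \<psi>_def)
  have "poly (pderiv r) a = poly R a" unfolding r_def rp by (rule poly_pderiv_linear_factor)
  then have \<psi>a: "poly \<psi> a = 1 / 2" by (simp add: \<psi>z rR half)
  define \<phi> where "\<phi> = (\<lambda>z. poly r z / z)"
  have a0: "a \<noteq> 0" using a by auto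
  have open0: "open (- {0::complex})" by (rule open_Compl) simp
  have \<phi>': "(\<phi> has_field_derivative poly \<psi> z / z\<^sup>2) (at z)" if "z \<noteq> 0" for z
    unfolding \<phi>_def
    by (rule derivative_eq_intros poly_DERIV refl that)+ (simp add: \<psi>z power2_eq_square algebra_simps)
  have \<phi>hol: "\<phi> holomorphic_on (- {0})"
    unfolding \<phi>_def by (intro holomorphic_intros) auto
  have "deriv \<phi> a \<noteq> 0" using DERIV_imp_deriv[OF \<phi>'[OF a0]] a0 by (simp add: \<psi>a)
  then obtain e1 where e1: "e1 > 0" "ball a e1 \<subseteq> - {0}" "inj_on \<phi> (ball a e1)"
    using has_complex_derivative_locally_injective[OF \<phi>hol _ open0, of a] a0 by auto
  have "isCont (poly \<psi>) a" by simp
  \<comment> \<open>Any tolerance below \<open>1 / 6\<close>, the distance from \<open>1 / 2\<close>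
    to \<open>1 / 3\<close>, leaves \<open>1 / 2\<close> as the only reciprocal of a natural number
    within reach.\<close>
  then obtain e2 where e2: "e2 > 0" "\<And>z. dist z a < e2 \<Longrightarrow> dist (poly \<psi> z) (poly \<psi> a) < 1 / 10"
    using continuous_at_eps_delta[of a "poly \<psi>"] by (metis dist_norm less_divide_eq_numeral1(1) zero_less_divide_1_iff zero_less_numeral continuous_at)
  \<comment> \<open>The value of \<open>\<psi>\<close> at 0 is \<open>- r(0) = - 1\<close>, so
    \<open>\<psi>\<close> is not the constant \<open>1 / 2\<close>.\<close>
  have "poly (\<psi> - [:1 / 2:]) 0 \<noteq> 0" by (simp add: \<psi>z rz)
  then have "\<psi> - [:1 / 2:] \<noteq> 0" by force
  then have "finite {z. poly (\<psi> - [:1 / 2:]) z = 0}" by (rule poly_roots_finite)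
  then obtain e3 where e3: "e3 > 0" "\<And>z. poly \<psi> z = 1 / 2 \<Longrightarrow> z \<noteq> a \<Longrightarrow> e3 \<le> dist a z"
    using finite_set_avoid[of "{z. poly (\<psi> - [:1 / 2:]) z = 0}" a] by auto
  define e where "e = Min {e1, e2, e3, 1 - cmod a}"
  have e: "e > 0" "e \<le> e1" "e \<le> e2" "e \<le> e3" "e \<le> 1 - cmod a"
    using e1(1) e2(1) e3(1) a by (auto simp: e_def)
  let ?B = "ball a e"
  have B1: "cmod z < 1" if "z \<in> ?B" for z
    using that e(5) norm_triangle_ineq2[of z a] by (simp add: dist_norm norm_minus_commute)
  have B0: "z \<noteq> 0" if "z \<in> ?B" for z using that e e1(2) by (auto simp: subset_iff)
  have inj: "inj_on \<phi> ?B" by (rule inj_on_subset[OF e1(3)]) (use e in auto)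
  have "\<phi> holomorphic_on ?B" by (rule holomorphic_on_subset[OF \<phi>hol]) (use B0[of 0] in auto)
  \<comment> \<open>By the open mapping theorem every small \<open>c\<close> is a value of
    \<open>\<phi>\<close> on the ball, which gives the moved root; injectivity makes it the only one
    there.\<close>
  then have "open (\<phi> ` ?B)" using inj by (intro open_mapping_thm3) auto
  moreover have "0 \<in> \<phi> ` ?B" using e by (intro image_eqI[of _ _ a]) (auto simp: \<phi>_def rR)
  ultimately obtain d1 where d1: "d1 > 0" "ball 0 d1 \<subseteq> \<phi> ` ?B" using open_contains_ball by blast
  \<comment> \<open>On the rest of the closed disk \<open>r\<close> stays away from 0, so a small
    \<open>c z\<close> cannot create a further root of \<open>r - c z\<close>.\<close>
  have "compact (poly r ` (cball 0 1 - ?B))"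
    by (intro compact_continuous_image continuous_intros compact_diff) auto
  then have "open (- (poly r ` (cball 0 1 - ?B)))" by (simp add: compact_imp_closed open_Compl)
  moreover have "0 \<in> - (poly r ` (cball 0 1 - ?B))"
    using e Rnz by (auto simp: rR)
  ultimately obtain d2 where d2: "d2 > 0" "ball 0 d2 \<subseteq> - (poly r ` (cball 0 1 - ?B))"
    using open_contains_ball by blast
  show thesis
  proof (rule that[of "min d1 d2"])
    show "0 < min d1 d2" using d1 d2 by simp
    fix c :: complex assume c: "c \<noteq> 0" "cmod c < min d1 d2"
    then have "c \<in> \<phi> ` ?B" using d1 by auto
    then obtain b where b: "b \<in> ?B" "\<phi> b = c" by blast
    have b0: "b \<noteq> 0" and b1: "cmod b < 1" using B0 B1 b by auto
    have ba: "b \<noteq> a" using b c by (auto simp: \<phi>_def rR)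
    have rb: "poly r b = c * b" using b(2) b0 by (auto simp: \<phi>_def)
    then have "poly (r - [:0, c:]) b = 0" by (simp add: mult.commute)
    then obtain R' where R': "r - [:0, c:] = [:- b, 1:] * R'"
      unfolding poly_eq_0_iff_dvd by (rule dvdE)
    have R'z: "poly r z - c * z = (z - b) * poly R' z" for z
      using arg_cong[OF R', of "\<lambda>q. poly q z"] by (simp add: algebra_simps)
    have "poly (pderiv (r - [:0, c:])) b = poly R' b" unfolding R' by (rule poly_pderiv_linear_factor)
    then have R'd: "poly R' b = poly (pderiv r) b - c" by (simp add: pderiv_diff pderiv_pCons)
    have R'b: "b * poly R' b = poly \<psi> b" unfolding R'd \<psi>z rb by (simp add: algebra_simps)
    have d: "dist b a < e" using b by (simp add: dist_commute)
    have \<psi>b: "dist (poly \<psi> b) (1 / 2) < 1 / 10" using e2(2)[of b] d e by (simp add: \<psi>a)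
    have \<psi>b': "poly \<psi> b \<noteq> 1 / 2" using e3(2)[of b] d e ba by (auto simp: dist_commute)
    have \<psi>b0: "poly \<psi> b \<noteq> 0" using \<psi>b by (auto simp: dist_norm)
    have sym: "one_zero_symbol p R' b c"
    proof
      show "cmod b < 1" by (rule b1)
      show "1 + z * (poly p z - c) = (z - b) * poly R' z" for z
        using R'z[of z] by (simp add: rz algebra_simps)
      fix z assume z: "cmod z \<le> 1"
      show "poly R' z \<noteq> 0"
      proof
        assume 0: "poly R' z = 0"
        then have rc: "poly r z = c * z" using R'z[of z] by simp
        show False
        proof (cases "z \<in> ?B")
          case True
          then have "\<phi> z = \<phi> b" using B0[OF True] rc b by (simp add: \<phi>_def)
          then have "z = b" using inj True b(1) by (auto dest: inj_onD)
          then show False using 0 R'b \<psi>b0 by simp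
        next
          case False
          have "cmod (poly r z) \<le> cmod c * 1" unfolding rc norm_mult using z by (intro mult_left_mono) auto
          then have "poly r z \<in> ball 0 d2" using c by simp
          then show False using d2(2) False z by auto
        qed
      qed
    qed
    moreover have "one_zero_symbol.\<mu> R' b \<noteq> of_nat n" for n
    proof
      assume "one_zero_symbol.\<mu> R' b = of_nat n"
      then have n: "1 / poly \<psi> b = of_nat n" by (simp add: one_zero_symbol.\<mu>_def[OF sym] R'b)
      then have n0: "n \<noteq> 0" using \<psi>b0 by (cases "n = 0") auto
      have "poly \<psi> b = 1 / of_nat n" using n \<psi>b0 by (metis div_by_1 divide_divide_eq_right mult_1)
      then have e: "poly \<psi> b = complex_of_real (1 / real n)" by simp
      have "dist (complex_of_real (1 / real n)) (complex_of_real (1 / 2)) < 1 / 10" using \<psi>b unfolding e by simp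
      then have close: "\<bar>1 / real n - 1 / 2\<bar> < 1 / 10" by (simp only: dist_of_real dist_real_def)
      have "n \<noteq> 2" using \<psi>b' e by auto
      moreover have "n \<noteq> 1" using close by auto
      ultimately have "n \<ge> 3" using n0 by linarith
      then have "1 / real n \<le> 1 / 3" by (intro divide_left_mono) auto
      then show False using close by linarith
    qed
    ultimately show "\<exists>b R'. one_zero_symbol p R' b c \<and> (\<forall>n. one_zero_symbol.\<mu> R' b \<noteq> of_nat n)" by blast
  qed
qed

theorem theorem4p1:
  fixes k :: nat
  assumes "k > 2"
  shows "\<exists>p :: complex poly. degree p = k \<and>
           (\<exists>w. isolated_point_of w (bergman_spectrum (toeplitz (\<lambda>z. cnj z + poly p z)))) \<and>
           \<not> connected (bergman_spectrum (toeplitz (\<lambda>z. cnj z + poly p z)))"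
proof -
  obtain p R :: "complex poly" and a :: complex where
    deg: "degree p = k" and a: "0 < cmod a" "cmod a < 1"
    and Rnz: "\<And>z. cmod z \<le> 1 \<Longrightarrow> poly R z \<noteq> 0"
    and rp: "pCons 1 p = [:- a, 1:] * R" and half: "a * poly R a = 1 / 2"
    using one_zero_poly_exists[OF assms] by blast
  let ?S = "bergman_spectrum (toeplitz (\<lambda>z. cnj z + poly p z))"
  have rz: "1 + z * poly p z = (z - a) * poly R z" for z
    using arg_cong[OF rp, of "\<lambda>q. poly q z"] by (simp add: algebra_simps)
  have sym: "one_zero_symbol p R a 0"
    by unfold_locales (use a Rnz rz in auto)
  have "one_zero_symbol.\<mu> R a = of_nat 2"
    unfolding one_zero_symbol.\<mu>_def[OF sym] half by simp
  from one_zero_symbol.not_invertible[OF sym this] have S0: "0 \<in> ?S"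
    by (simp add: bergman_spectrum_def)
  obtain e where e: "e > 0" and inv: "\<And>c. c \<noteq> 0 \<Longrightarrow> cmod c < e \<Longrightarrow>
       \<exists>b R'. one_zero_symbol p R' b c \<and> (\<forall>n. one_zero_symbol.\<mu> R' b \<noteq> of_nat n)"
    using zero_perturbation[OF a Rnz rp half] by blast
  have notin: "c \<notin> ?S" if "c \<noteq> 0" "cmod c < e" for c
    using inv[OF that] one_zero_symbol.invertible by (auto simp: bergman_spectrum_def)
  have "x = 0" if "x \<in> ?S" "cmod x < e" for x using notin[of x] that by blast
  then have "?S \<inter> ball 0 e = {0}" using S0 e by auto
  then have iso: "isolated_point_of 0 ?S" using S0 e unfolding isolated_point_of_def by blast
  \<comment> \<open>The second spectral point; it equals \<open>(1 - a) * poly R 1\<close>, which is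
    nonzero since neither \<open>a\<close> nor a zero of \<open>R\<close> lies at 1.\<close>
  have S1: "cnj 1 + poly p 1 \<in> ?S"
    using circle_point_not_invertible[of 1 p] by (simp add: bergman_spectrum_def)
  have "cnj 1 + poly p 1 = (1 - a) * poly R 1" using rz[of 1] by simp
  moreover have "\<dots> \<noteq> 0" using a Rnz[of 1] by auto
  ultimately have ne: "cnj 1 + poly p 1 \<noteq> 0" by simp
  have "\<not> connected ?S"
  proof
    assume con: "connected ?S"
    \<comment> \<open>A connected set with more than one point has no isolated points.\<close>
    have "0 islimpt ?S"
      by (rule connected_imp_perfect[OF con S0]) (use S0 S1 ne in \<open>metis singletonD\<close>)
    then obtain x where "x \<in> ?S" "x \<noteq> 0" "dist x 0 < e" using e unfolding islimpt_approachable by blast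
    then show False using notin[of x] by simp
  qed
  with deg iso show ?thesis by blast
qed

end
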